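(* Let $n_1\in\mathbb{N}$, $A>1$, and let $$\mathcal{C}=\Bigl\{f\in\mathcal{F}:\|f\|_{\mathcal{F}}\le A\,\bigl\|(\widehat f(\boldsymbol{k}_i)/\lambda_{\boldsymbol{k}_i})_{i=1}^{n_1}\bigr\|_\rho\Bigr\}.$$ Let $\mathrm{ALG}$ be the algorithm that, given $f$ and $\varepsilon>0$, returns $\mathrm{ALG}(f,\varepsilon)=\mathrm{APP}(f,n)$ where $n$ is the smallest integer $n\ge n_1$ with $\mathrm{ERR}\bigl((\widehat f(\boldsymbol{k}_i))_{i=1}^n,n\bigr)\le\varepsilon$. Then: (i) $\mathrm{ALG}\in\mathcal{A}(\mathcal{C})$, i.e. $\|\mathrm{SOL}(f)-\mathrm{ALG}(f,\varepsilon)\|_{\mathcal{G}}\le\varepsilon$ for all $\varepsilon>0$ and $f\in\mathcal{C}$. (ii) The information cost is $$\mathrm{COST}(\mathrm{ALG},\mathcal{C},\varepsilon,R)=\min\Bigl\{n\ge n_1:\bigl\|(\lambda_{\boldsymbol{k}_i})_{i=n+1}^\infty\bigr\|_{\rho'}\le\frac{\varepsilon}{(A^\rho-1)^{1/\rho}R}\Bigr\}.$$ (iii) There exist positive $\varepsilon_{\max}$ and $R_{\min}$ such that $$\mathrm{COMP}(\mathcal{A}(\mathcal{C}),\varepsilon,R)\ge\min\Bigl\{n\ge n_1:\bigl\|(\lambda_{\boldsymbol{k}_i})_{i=n+1}^\infty\bigr\|_{\rho'}\le\frac{2\varepsilon}{(1-1/A)R}\Bigr\}\qquad\forall\,\varepsilon\in(0,\varepsilon_{\max}],\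 R\in[R_{\min},\infty).$$ (iv) $\mathrm{ALG}$ is essentially optimal for $\mathcal{C}$. (v) $\mathcal{A}(\mathcal{C})$ contains only adaptive algorithms.
   Context: Setting. $\mathbb{K}$ is a countably infinite index set of "wavenumbers" and $1\le\tau\le\rho\le\infty$. The weights $\boldsymbol{\lambda}=(\lambda_{\boldsymbol{k}})_{\boldsymbol{k}\in\mathbb{K}}$ are positive, and $\mathbb{K}=\{\boldsymbol{k}_1,\boldsymbol{k}_2,\dots\}$ is enumerated so that $\lambda_{\boldsymbol{k}_1}\ge\lambda_{\boldsymbol{k}_2}\ge\cdots>0$. The number $\rho'\in[\tau,\infty]$ is defined by $1/\rho+1/\rho'=1/\tau$, and it is assumed throughout that $\|\boldsymbol{\lambda}\|_{\rho'}<\infty$. Here $\|\cdot\|_p$ is the $\ell^p$ norm of a sequence. (A minimum over an empty set of integers is $+\infty$.) The input and output Banach spaces, with bases $\{u_{\boldsymbol{k}}\}$ and $\{v_{\boldsymbol{k}}\}$ (elements are identified with their coefficient sequences), are $$\mathcal{F}=\Bigl\{f=\sum_{\boldsymbol{k}\in\mathbb{K}}\widehat f(\boldsymbol{k})u_{\boldsymbol{k}}:\|f\|_{\mathcal{F}}:=\bigl\|(\widehat f(\boldsymbol{k})/\lambda_{\boldsymbol{k}})_{\boldsymbol{k}\in\mathbb{K}}\bigr\|_\rho<\infty\Bigr\},\quad \mathcal{G}=\Bigl\{g=\sum_{\boldsymbol{k}\in\mathbb{K}}\widehat g(\boldsymbol{k})v_{\boldsymbol{k}}:\|g\|_{\mathcal{G}}:=\bigl\|(\widehat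 g(\boldsymbol{k}))_{\boldsymbol{k}\in\mathbb{K}}\bigr\|_\tau<\infty\Bigr\}.$$ The solution operator is $\mathrm{SOL}:\mathcal{F}\to\mathcal{G}$, $\mathrm{SOL}(f)=\sum_{\boldsymbol{k}}\widehat f(\boldsymbol{k})v_{\boldsymbol{k}}$. $\mathcal{B}_R=\{f\in\mathcal{F}:\|f\|_{\mathcal{F}}\le R\}$. $\mathrm{APP}(f,0)=0$, $\mathrm{APP}(f,n)=\sum_{i=1}^n\widehat f(\boldsymbol{k}_i)v_{\boldsymbol{k}_i}$. Data-based error bound: for $n\ge n_1$, $$\mathrm{ERR}\bigl((\widehat f(\boldsymbol{k}_i))_{i=1}^n,n\bigr)=\Bigl[A^\rho\bigl\|(\widehat f(\boldsymbol{k}_i)/\lambda_{\boldsymbol{k}_i})_{i=1}^{n_1}\bigr\|_\rho^\rho-\bigl\|(\widehat f(\boldsymbol{k}_i)/\lambda_{\boldsymbol{k}_i})_{i=1}^{n}\bigr\|_\rho^\rho\Bigr]^{1/\rho}\bigl\|(\lambda_{\boldsymbol{k}_i})_{i=n+1}^\infty\bigr\|_{\rho'}.$$ For $\rho=\infty$ the bracket $[\cdots]^{1/\rho}$ is read as $A\|(\widehat f(\boldsymbol{k}_i)/\lambda_{\boldsymbol{k}_i})_{i=1}^{n_1}\|_\infty$ and $(A^\rho-1)^{1/\rho}$ as $A$. For $\mathcal{C}\subseteq\mathcal{F}$, $\mathcal{A}(\mathcal{C})$ is the set of all (deterministic) algorithms $\mathrm{ALG}$ that use only finitely many series coefficients of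 the input (the number and choice of which may depend adaptively on the coefficient values already observed and on $\varepsilon$) and satisfy $\|\mathrm{SOL}(f)-\mathrm{ALG}(f,\varepsilon)\|_{\mathcal{G}}\le\varepsilon$ for all $\varepsilon>0$, $f\in\mathcal{C}$. An algorithm is non-adaptive if the coefficients it samples depend only on $\varepsilon$ and not on $f$; otherwise it is adaptive. $\mathrm{COST}(\mathrm{ALG},f,\varepsilon)$ is the number of series coefficients used by $\mathrm{ALG}(f,\varepsilon)$, $$\mathrm{COST}(\mathrm{ALG},\mathcal{C},\varepsilon,R)=\max_{f\in\mathcal{C}\cap\mathcal{B}_R}\mathrm{COST}(\mathrm{ALG},f,\varepsilon),\qquad \mathrm{COMP}(\mathcal{A}(\mathcal{C}),\varepsilon,R)=\min_{\mathrm{ALG}\in\mathcal{A}(\mathcal{C})}\mathrm{COST}(\mathrm{ALG},\mathcal{C},\varepsilon,R).$$ $\mathrm{ALG}$ is essentially optimal for $\mathcal{C}$ if there exist fixed positive $\omega,\varepsilon_{\max},R_{\min}$ with $\mathrm{COST}(\mathrm{ALG},\mathcal{C},\varepsilon,R)\le\mathrm{COMP}(\mathcal{A}(\mathcal{C}),\omega\varepsilon,R)$ for all $\varepsilon\in(0,\varepsilon_{\max}]$, $R\in[R_{\min},\infty)$.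
   Formalization: In (i), ALG ∈ A(C) is claimed only if τ<ρ or λ_{k_i}→0; if τ=ρ and λ does not tend to 0 (e.g. λ≡1), ALG never stops for some f and ε, so the claim fails. The error bound is stated for every f∈C on which ALG stops; n_1≥1. *)

theory Defs
  imports "HOL-Analysis.Analysis"
begin

(* Exponents are of type ennreal, so that infinity is allowed and inverse infinity = 0.
   The real number lp_norm p S x is the norm of (x i), i : S, only if lp_finite p S x.
   The element 0 inserted below the supremum matters for S = {} only. *)
definition lp_finite :: "ennreal \<Rightarrow> 'i set \<Rightarrow> ('i \<Rightarrow> 'b::real_normed_vector) \<Rightarrow> bool" where
  "lp_finite p S x \<longleftrightarrow>
     (if p = \<infinity> then bdd_above ((\<lambda>i. norm (x i)) ` S)
      else (\<lambda>i. norm (x i) powr enn2real p) summable_on S)"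

definition lp_norm :: "ennreal \<Rightarrow> 'i set \<Rightarrow> ('i \<Rightarrow> 'b::real_normed_vector) \<Rightarrow> real" where
  "lp_norm p S x =
     (if p = \<infinity> then Sup (insert 0 ((\<lambda>i. norm (x i)) ` S))
      else (\<Sum>\<^sub>\<infinity>i\<in>S. norm (x i) powr enn2real p) powr (1 / enn2real p))"

(* Elements of the input and output spaces are identified with their coefficient
   families with respect to the bases u and v. The set of wavenumbers is the type 'k. *)
definition weighted ::
  "('k \<Rightarrow> real) \<Rightarrow> ('k \<Rightarrow> 'a::{real_normed_field,banach}) \<Rightarrow> 'k \<Rightarrow> 'a" where
  "weighted lam f = (\<lambda>j. f j / of_real (lam j))"

definition F_space ::
  "ennreal \<Rightarrow> ('k \<Rightarrow> real) \<Rightarrow> ('k \<Rightarrow> 'a::{real_normed_field,banach}) set" where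
  "F_space \<rho> lam = {f. lp_finite \<rho> UNIV (weighted lam f)}"

definition F_norm ::
  "ennreal \<Rightarrow> ('k \<Rightarrow> real) \<Rightarrow> ('k \<Rightarrow> 'a::{real_normed_field,banach}) \<Rightarrow> real" where
  "F_norm \<rho> lam f = lp_norm \<rho> UNIV (weighted lam f)"

definition F_ball ::
  "ennreal \<Rightarrow> ('k \<Rightarrow> real) \<Rightarrow> real \<Rightarrow> ('k \<Rightarrow> 'a::{real_normed_field,banach}) set" where
  "F_ball \<rho> lam R = {f \<in> F_space \<rho> lam. F_norm \<rho> lam f \<le> R}"

definition G_space :: "ennreal \<Rightarrow> ('k \<Rightarrow> 'a::{real_normed_field,banach}) set" where
  "G_space \<tau> = {g. lp_finite \<tau> UNIV g}"

definition G_norm :: "ennreal \<Rightarrow> ('k \<Rightarrow> 'a::{real_normed_field,banach}) \<Rightarrow> real" where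
  "G_norm \<tau> g = lp_norm \<tau> UNIV g"

(* The u-coefficients of f are the v-coefficients of SOL f. *)
definition SOL :: "('k \<Rightarrow> 'a) \<Rightarrow> 'k \<Rightarrow> 'a" where
  "SOL f = (\<lambda>j. f j)"

(* Throughout, k 1, k 2, ... is the enumeration of the wavenumbers; k 0 is not used. *)
definition APP :: "(nat \<Rightarrow> 'k) \<Rightarrow> ('k \<Rightarrow> 'a::zero) \<Rightarrow> nat \<Rightarrow> 'k \<Rightarrow> 'a" where
  "APP k f n = (\<lambda>j. if j \<in> k ` {1..n} then f j else 0)"

definition head_norm ::
  "ennreal \<Rightarrow> ('k \<Rightarrow> real) \<Rightarrow> (nat \<Rightarrow> 'k) \<Rightarrow> ('k \<Rightarrow> 'a::{real_normed_field,banach}) \<Rightarrow> nat \<Rightarrow> real"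
  where
  "head_norm \<rho> lam k f n = lp_norm \<rho> {1..n} (\<lambda>i. weighted lam f (k i))"

definition tail_norm :: "ennreal \<Rightarrow> ('k \<Rightarrow> real) \<Rightarrow> (nat \<Rightarrow> 'k) \<Rightarrow> nat \<Rightarrow> real" where
  "tail_norm \<rho>' lam k n = lp_norm \<rho>' {n+1..} (\<lambda>i. lam (k i))"

(* Although written as a function of f, ERR depends only on f (k 1), ..., f (k n) if n1 \<le> n
   (see ERR_cong). The bracket is nonnegative for f in the cone below. *)
definition ERR ::
  "ennreal \<Rightarrow> ennreal \<Rightarrow> ('k \<Rightarrow> real) \<Rightarrow> (nat \<Rightarrow> 'k) \<Rightarrow> nat \<Rightarrow> real \<Rightarrow>
     ('k \<Rightarrow> 'a::{real_normed_field,banach}) \<Rightarrow> nat \<Rightarrow> real" where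
  "ERR \<rho> \<rho>' lam k n1 A f n =
     (if \<rho> = \<infinity> then A * head_norm \<rho> lam k f n1
      else (A powr enn2real \<rho> * head_norm \<rho> lam k f n1 powr enn2real \<rho>
              - head_norm \<rho> lam k f n powr enn2real \<rho>) powr (1 / enn2real \<rho>))
     * tail_norm \<rho>' lam k n"

(* (A^\<rho> - 1)^(1/\<rho>), read as A for infinite \<rho> *)
definition inflation :: "ennreal \<Rightarrow> real \<Rightarrow> real" where
  "inflation \<rho> A =
     (if \<rho> = \<infinity> then A else (A powr enn2real \<rho> - 1) powr (1 / enn2real \<rho>))"

definition data_cone ::
  "ennreal \<Rightarrow> ('k \<Rightarrow> real) \<Rightarrow> (nat \<Rightarrow> 'k) \<Rightarrow> nat \<Rightarrow> real \<Rightarrow>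
     ('k \<Rightarrow> 'a::{real_normed_field,banach}) set" where
  "data_cone \<rho> lam k n1 A =
     {f \<in> F_space \<rho> lam. F_norm \<rho> lam f \<le> A * head_norm \<rho> lam k f n1}"

(* A deterministic algorithm decides, from the tolerance and the list of coefficients observed
   so far (oldest first), which coefficient to sample next, or which element to return. *)
datatype ('k, 'a) action = Sample 'k | Return "'k \<Rightarrow> 'a"

type_synonym ('k, 'a) algorithm = "real \<Rightarrow> ('k \<times> 'a) list \<Rightarrow> ('k, 'a) action"

primrec observed ::
  "('k, 'a) algorithm \<Rightarrow> real \<Rightarrow> ('k \<Rightarrow> 'a) \<Rightarrow> nat \<Rightarrow> ('k \<times> 'a) list" where
  "observed alg \<epsilon> f 0 = []"
| "observed alg \<epsilon> f (Suc m) =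
     (case alg \<epsilon> (observed alg \<epsilon> f m) of
        Sample j \<Rightarrow> observed alg \<epsilon> f m @ [(j, f j)]
      | Return g \<Rightarrow> observed alg \<epsilon> f m)"

(* For given alg, \<epsilon>, f this holds for at most one g, and for none if alg does not terminate. *)
definition returns ::
  "('k, 'a) algorithm \<Rightarrow> real \<Rightarrow> ('k \<Rightarrow> 'a) \<Rightarrow> ('k \<Rightarrow> 'a) \<Rightarrow> bool" where
  "returns alg \<epsilon> f g \<longleftrightarrow> (\<exists>m. alg \<epsilon> (observed alg \<epsilon> f m) = Return g)"

definition sampled :: "('k, 'a) algorithm \<Rightarrow> real \<Rightarrow> ('k \<Rightarrow> 'a) \<Rightarrow> 'k set" where
  "sampled alg \<epsilon> f = (\<Union>m. fst ` set (observed alg \<epsilon> f m))"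

definition algorithms ::
  "ennreal \<Rightarrow> ('k \<Rightarrow> 'a::{real_normed_field,banach}) set \<Rightarrow> ('k, 'a) algorithm set" where
  "algorithms \<tau> C =
     {alg. \<forall>\<epsilon>>0. \<forall>f\<in>C. \<exists>g\<in>G_space \<tau>.
        returns alg \<epsilon> f g \<and> G_norm \<tau> (\<lambda>j. SOL f j - g j) \<le> \<epsilon>}"

(* Required for inputs from C only, so that this is implied by non-adaptivity on the whole space. *)
definition non_adaptive :: "('k \<Rightarrow> 'a) set \<Rightarrow> ('k, 'a) algorithm \<Rightarrow> bool" where
  "non_adaptive C alg \<longleftrightarrow>
     (\<forall>\<epsilon>>0. \<forall>f\<in>C. \<forall>g\<in>C. sampled alg \<epsilon> f = sampled alg \<epsilon> g)"

(* Distinct coefficients are counted. *)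
definition cost :: "('k, 'a) algorithm \<Rightarrow> ('k \<Rightarrow> 'a) \<Rightarrow> real \<Rightarrow> enat" where
  "cost alg f \<epsilon> =
     (if finite (sampled alg \<epsilon> f) then enat (card (sampled alg \<epsilon> f)) else \<infinity>)"

definition COST ::
  "ennreal \<Rightarrow> ('k \<Rightarrow> real) \<Rightarrow> ('k, 'a::{real_normed_field,banach}) algorithm \<Rightarrow>
     ('k \<Rightarrow> 'a) set \<Rightarrow> real \<Rightarrow> real \<Rightarrow> enat" where
  "COST \<rho> lam alg C \<epsilon> R = (SUP f\<in>C \<inter> F_ball \<rho> lam R. cost alg f \<epsilon>)"

definition COMP ::
  "ennreal \<Rightarrow> ennreal \<Rightarrow> ('k \<Rightarrow> real) \<Rightarrow> ('k \<Rightarrow> 'a::{real_normed_field,banach}) set \<Rightarrow>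
     real \<Rightarrow> real \<Rightarrow> enat" where
  "COMP \<tau> \<rho> lam C \<epsilon> R = (INF alg\<in>algorithms \<tau> C. COST \<rho> lam alg C \<epsilon> R)"

definition essentially_optimal ::
  "ennreal \<Rightarrow> ennreal \<Rightarrow> ('k \<Rightarrow> real) \<Rightarrow> ('k \<Rightarrow> 'a::{real_normed_field,banach}) set \<Rightarrow>
     ('k, 'a) algorithm \<Rightarrow> bool" where
  "essentially_optimal \<tau> \<rho> lam C alg \<longleftrightarrow>
     (\<exists>\<omega>>0. \<exists>\<epsilon>max>0. \<exists>Rmin>0. \<forall>\<epsilon> R. 0 < \<epsilon> \<longrightarrow> \<epsilon> \<le> \<epsilon>max \<longrightarrow> Rmin \<le> R \<longrightarrow>
        COST \<rho> lam alg C \<epsilon> R \<le> COMP \<tau> \<rho> lam C (\<omega> * \<epsilon>) R)"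

(* The smallest n in a set of natural numbers, infinity for the empty set. *)
definition first_n :: "(nat \<Rightarrow> bool) \<Rightarrow> enat" where
  "first_n P = Inf (enat ` {n. P n})"

(* The observed coefficients, extended by 0. *)
definition known :: "('k \<times> 'a::zero) list \<Rightarrow> 'k \<Rightarrow> 'a" where
  "known h = (\<lambda>j. case map_of h j of Some y \<Rightarrow> y | None \<Rightarrow> 0)"

definition cone_alg ::
  "ennreal \<Rightarrow> ennreal \<Rightarrow> ('k \<Rightarrow> real) \<Rightarrow> (nat \<Rightarrow> 'k) \<Rightarrow> nat \<Rightarrow> real \<Rightarrow>
     ('k, 'a::{real_normed_field,banach}) algorithm" where
  "cone_alg \<rho> \<rho>' lam k n1 A \<epsilon> h =
     (let n = length h in
      if n1 \<le> n \<and> ERR \<rho> \<rho>' lam k n1 A (known h) n \<le> \<epsilon> then Return (APP k (known h) n)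
      else Sample (k (n + 1)))"

lemma lp_norm_cong:
  assumes "\<And>i. i \<in> S \<Longrightarrow> x i = y i"
  shows "lp_norm p S x = lp_norm p S y"
proof -
  have "(\<lambda>i. norm (x i)) ` S = (\<lambda>i. norm (y i)) ` S"
    using assms by (intro image_cong) auto
  moreover have "(\<Sum>\<^sub>\<infinity>i\<in>S. norm (x i) powr enn2real p) = (\<Sum>\<^sub>\<infinity>i\<in>S. norm (y i) powr enn2real p)"
    using assms by (intro infsum_cong) auto
  ultimately show ?thesis
    by (simp add: lp_norm_def)
qed

lemma ERR_cong:
  assumes "\<And>i. i \<in> {1..n} \<Longrightarrow> f (k i) = g (k i)" and "n1 \<le> n"
  shows "ERR \<rho> \<rho>' lam k n1 A f n = ERR \<rho> \<rho>' lam k n1 A g n"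
proof -
  have "head_norm \<rho> lam k f m = head_norm \<rho> lam k g m" if "m \<le> n" for m
    unfolding head_norm_def weighted_def using assms(1) that by (intro lp_norm_cong) auto
  from this[OF assms(2)] this[OF order_refl] show ?thesis by (simp only: ERR_def)
qed

lemma known_samples:
  "known (map (\<lambda>i. (k i, f (k i))) [1..<Suc n]) = APP k f n"
proof -
  have *: "map_of (map (\<lambda>i. (k i, f (k i))) xs) j = (if j \<in> k ` set xs then Some (f j) else None)"
    for xs :: "nat list" and j
    by (induction xs) auto
  have "set [1..<Suc n] = {1..n}" by auto
  then show ?thesis by (simp only: known_def APP_def *) auto
qed

(* cone_alg returns APP k f n for the smallest n \<ge> n1 with ERR \<le> \<epsilon>, and nothing if there is none *)
context
  fixes \<rho> \<rho>' :: ennreal and lam :: "'k \<Rightarrow> real" and k :: "nat \<Rightarrow> 'k" and n1 :: nat and A \<epsilon> :: real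
    and f :: "'k \<Rightarrow> 'a::{real_normed_field,banach}"
begin

private definition stop where
  "stop n \<longleftrightarrow> n1 \<le> n \<and> ERR \<rho> \<rho>' lam k n1 A f n \<le> \<epsilon>"

private definition hist where
  "hist n = map (\<lambda>i. (k i, f (k i))) [1..<Suc n]"

private lemma cone_alg_hist:
  "cone_alg \<rho> \<rho>' lam k n1 A \<epsilon> (hist n) =
     (if stop n then Return (APP k f n) else Sample (k (n + 1)))"
proof -
  have 1: "known (hist n) = APP k f n"
    unfolding hist_def by (rule known_samples)
  have 2: "ERR \<rho> \<rho>' lam k n1 A (APP k f n) n = ERR \<rho> \<rho>' lam k n1 A f n" if "n1 \<le> n"
    using that by (intro ERR_cong) (auto simp: APP_def)
  have 3: "APP k (APP k f n) n = APP k f n" by (auto simp: APP_def)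
  have 4: "length (hist n) = n" by (simp add: hist_def)
  show ?thesis
    unfolding cone_alg_def Let_def 4 1 3 stop_def using 2 by auto
qed

private lemma observed_before:
  "(\<And>i. i < m \<Longrightarrow> \<not> stop i) \<Longrightarrow> observed (cone_alg \<rho> \<rho>' lam k n1 A) \<epsilon> f m = hist m"
proof (induction m)
  case 0
  then show ?case by (simp add: hist_def)
next
  case (Suc m)
  then have "observed (cone_alg \<rho> \<rho>' lam k n1 A) \<epsilon> f m = hist m" "\<not> stop m" by auto
  then show ?case by (simp add: cone_alg_hist) (simp add: hist_def)
qed

private lemma observed_after:
  assumes "stop n" "\<And>i. i < n \<Longrightarrow> \<not> stop i"
  shows "observed (cone_alg \<rho> \<rho>' lam k n1 A) \<epsilon> f (n + d) = hist n"
proof (induction d)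
  case 0
  then show ?case using observed_before[of n] assms by simp
next
  case (Suc d)
  then show ?case using assms(1) by (simp add: cone_alg_hist)
qed

private lemma cases_stop:
  obtains "\<And>n. \<not> stop n" | n where "stop n" "\<And>i. i < n \<Longrightarrow> \<not> stop i"
  by (metis exists_least_iff)

lemma returns_cone_alg_iff:
  "returns (cone_alg \<rho> \<rho>' lam k n1 A) \<epsilon> f g \<longleftrightarrow>
     (\<exists>n. n1 \<le> n \<and> ERR \<rho> \<rho>' lam k n1 A f n \<le> \<epsilon> \<and>
          (\<forall>i. n1 \<le> i \<and> i < n \<longrightarrow> \<not> ERR \<rho> \<rho>' lam k n1 A f i \<le> \<epsilon>) \<and> g = APP k f n)"
proof -
  have "returns (cone_alg \<rho> \<rho>' lam k n1 A) \<epsilon> f g \<longleftrightarrow>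
     (\<exists>n. stop n \<and> (\<forall>i<n. \<not> stop i) \<and> g = APP k f n)"
  proof (cases rule: cases_stop)
    case 1
    then show ?thesis by (simp add: returns_def observed_before cone_alg_hist)
  next
    case (2 n)
    have uniq: "n' = n" if "stop n'" "\<forall>i<n'. \<not> stop i" for n'
      using 2 that by (meson linorder_neqE_nat)
    have step: "cone_alg \<rho> \<rho>' lam k n1 A \<epsilon> (observed (cone_alg \<rho> \<rho>' lam k n1 A) \<epsilon> f m) =
        (if m < n then Sample (k (m + 1)) else Return (APP k f n))" for m
    proof (cases "m < n")
      case True
      then show ?thesis using observed_before[of m] 2 by (simp add: cone_alg_hist)
    next
      case False
      then show ?thesis using observed_after[of n "m - n"] 2 by (simp add: cone_alg_hist)
    qed
    have "returns (cone_alg \<rho> \<rho>' lam k n1 A) \<epsilon> f g \<longleftrightarrow> g = APP k f n"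
      unfolding returns_def step by (auto split: if_splits)
    then show ?thesis using 2 uniq by blast
  qed
  then show ?thesis unfolding stop_def by auto
qed

end

end

theory Submission
  imports Defs
begin

text \<open>
  The error of \<open>APP k f n\<close> is the product of the weighted coefficients of \<open>f\<close> and the weights, both
  taken beyond the first \<open>n\<close> wavenumbers. Hoelder's inequality (\<open>hoelder\<close>) bounds it by the norm of the
  unsampled weighted coefficients times the tail norm of the weights. An input in the cone reveals
  the first factor: its whole norm is at most \<open>A\<close> times the norm of its first \<open>n1\<close> weighted
  coefficients, and what has been sampled can be subtracted. This is why \<open>ERR\<close> bounds the error
  (\<open>ERR_bounds_error\<close>), so whatever the algorithm returns is accurate. It does return something if the
  tail norms tend to zero, because on a ball \<open>ERR\<close> is at most a constant times the tail norm
  (\<open>residual_le\<close>). This bound is attained by an input concentrated in the first coefficient, which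
  gives the exact cost (\<open>COST_cone_alg\<close>).

  The lower bound is a fooling argument (\<open>sampling_lower_bound\<close>). A center of norm
  \<open>(1 + 1 / A) / 2 * R\<close>, concentrated in the first coefficient, stays in the cone when any
  perturbation of norm \<open>(1 - 1 / A) / 2 * R\<close> is added or subtracted (\<open>perturbation_in_cone\<close>). If the perturbation avoids the
  wavenumbers sampled for the center, both modified inputs produce the same answer, so the
  perturbation has output norm at most \<open>\<epsilon>\<close>. The worst perturbation realises the norm of the weights
  outside the sample (\<open>hoelder_converse\<close>), and since the weights decrease, no sample of \<open>m\<close> wavenumbers
  does better than the first \<open>m\<close> (\<open>lp_le_weights_outside\<close>). Hence \<open>m\<close> samples suffice for the center only
  if the tail norm at \<open>m\<close> is at most \<open>2 * \<epsilon> / ((1 - 1 / A) * R)\<close>.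

  This differs from the exact cost by a constant factor in \<open>\<epsilon>\<close> only, which is essential optimality.
  It also excludes non-adaptive algorithms: they would have to serve the centers of all sizes \<open>R\<close>
  with one finite sample, although the tail norms are positive.
\<close>

section \<open>Norm bounds through finite partial sums\<close>

text \<open>
  The conjunction of \<open>lp_finite\<close> and \<open>lp_norm \<le> c\<close> for \<open>1 \<le> p\<close> and \<open>0 \<le> c\<close> (see \<open>lp_le_iff\<close>),
  phrased through finite partial sums. Norm estimates are stated with it below, so that a single
  predicate carries both convergence and size, and an estimate between infinite families needs to
  be proved for finite sums only.
\<close>

definition lp_le :: "ennreal \<Rightarrow> 'i set \<Rightarrow> ('i \<Rightarrow> 'b::real_normed_vector) \<Rightarrow> real \<Rightarrow> bool" where
  "lp_le p S x c \<longleftrightarrow>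
     (if p = \<infinity> then \<forall>i\<in>S. norm (x i) \<le> c
      else \<forall>F. finite F \<longrightarrow> F \<subseteq> S \<longrightarrow>
        (\<Sum>i\<in>F. norm (x i) powr enn2real p) \<le> c powr enn2real p)"

lemma enn2real_ge_1: "1 \<le> p \<Longrightarrow> p \<noteq> \<infinity> \<Longrightarrow> 1 \<le> enn2real p"
  by (metis enn2real_1 enn2real_mono infinity_ennreal_def less_top)

lemma lp_norm_nonneg: "lp_finite p S x \<Longrightarrow> 0 \<le> lp_norm p S x"
  by (auto simp: lp_norm_def lp_finite_def intro!: cSup_upper)

lemma lp_le_iff:
  assumes p: "1 \<le> p" and c: "0 \<le> c"
  shows "lp_le p S x c \<longleftrightarrow> lp_finite p S x \<and> lp_norm p S x \<le> c"
proof (cases "p = \<infinity>")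
  case True
  let ?N = "(\<lambda>i. norm (x i)) ` S"
  have "(\<forall>i\<in>S. norm (x i) \<le> c) \<longleftrightarrow> bdd_above ?N \<and> Sup (insert 0 ?N) \<le> c"
  proof (cases "bdd_above ?N")
    case True
    then have "Sup (insert 0 ?N) \<le> c \<longleftrightarrow> (\<forall>z\<in>insert 0 ?N. z \<le> c)"
      by (intro cSup_le_iff) auto
    then show ?thesis using True c by auto
  qed (auto simp: bdd_above_def)
  then show ?thesis using True by (simp add: lp_le_def lp_finite_def lp_norm_def)
next
  case False
  define e where "e = enn2real p"
  have e: "1 \<le> e" unfolding e_def by (rule enn2real_ge_1[OF p False])
  let ?g = "\<lambda>i. norm (x i) powr e"
  have root: "lp_norm p S x \<le> c \<longleftrightarrow> infsum ?g S \<le> c powr e"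
  proof -
    have nn: "0 \<le> infsum ?g S" by (intro infsum_nonneg) auto
    have "infsum ?g S powr (1/e) \<le> c \<longleftrightarrow> infsum ?g S \<le> c powr e"
    proof
      assume "infsum ?g S powr (1/e) \<le> c"
      then have "(infsum ?g S powr (1/e)) powr e \<le> c powr e"
        using e by (intro powr_mono2) auto
      then show "infsum ?g S \<le> c powr e" using nn e by (simp add: powr_powr)
    next
      assume "infsum ?g S \<le> c powr e"
      then have "infsum ?g S powr (1/e) \<le> (c powr e) powr (1/e)"
        using nn e by (intro powr_mono2) auto
      then show "infsum ?g S powr (1/e) \<le> c" using c e by (simp add: powr_powr)
    qed
    then show ?thesis using False by (simp add: lp_norm_def e_def)
  qed
  show ?thesis
  proof
    assume *: "lp_le p S x c"
    then have le: "sum ?g F \<le> c powr e" if "finite F" "F \<subseteq> S" for F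
      using that False by (auto simp: lp_le_def e_def)
    have sm: "?g summable_on S"
      by (intro nonneg_bdd_above_summable_on bdd_aboveI2[where M="c powr e"]) (use le in auto)
    moreover have "infsum ?g S \<le> c powr e"
      by (intro infsum_le_finite_sums sm le)
    ultimately show "lp_finite p S x \<and> lp_norm p S x \<le> c"
      using False root by (simp add: lp_finite_def e_def)
  next
    assume *: "lp_finite p S x \<and> lp_norm p S x \<le> c"
    then have "sum ?g F \<le> c powr e" if "finite F" "F \<subseteq> S" for F
      using finite_sum_le_infsum[of ?g S F] that root False
      by (auto simp: lp_finite_def e_def)
    then show "lp_le p S x c" using False by (auto simp: lp_le_def e_def)
  qed
qed

lemma lp_le_finite:
  assumes "finite S" "p \<noteq> \<infinity>"
  shows "lp_le p S x c \<longleftrightarrow> (\<Sum>i\<in>S. norm (x i) powr enn2real p) \<le> c powr enn2real p"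
proof -
  have "(\<Sum>i\<in>F. norm (x i) powr enn2real p) \<le> (\<Sum>i\<in>S. norm (x i) powr enn2real p)"
    if "F \<subseteq> S" for F
    using that assms(1) by (intro sum_mono2) auto
  then show ?thesis using assms unfolding lp_le_def by (auto intro: order_trans)
qed

lemma lp_le_mono:
  assumes "lp_le p S x c" "0 \<le> c" "c \<le> d"
  shows "lp_le p S x d"
proof -
  have "c powr enn2real p \<le> d powr enn2real p" using assms by (intro powr_mono2) auto
  with assms show ?thesis unfolding lp_le_def by (meson order_trans)
qed

lemma lp_le_singleton:
  assumes "1 \<le> p" "0 \<le> c"
  shows "lp_le p {j} x c \<longleftrightarrow> norm (x j) \<le> c"
proof (cases "p = \<infinity>")
  case False
  then have "0 < enn2real p" using enn2real_ge_1[OF assms(1)] by simp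
  then have "norm (x j) powr enn2real p \<le> c powr enn2real p \<longleftrightarrow> norm (x j) \<le> c"
    using assms(2) by (metis linorder_not_le norm_ge_zero order_less_imp_le powr_less_mono2 powr_mono2)
  then show ?thesis using False by (simp add: lp_le_finite)
qed (simp add: lp_le_def)

text \<open>
  Allowing an injective relabelling \<open>\<psi>\<close> covers restriction to a subset, change of the index
  set, and the rearrangement argument in \<open>lp_le_weights_outside\<close> at once.
\<close>

lemma lp_le_dominated:
  assumes y: "lp_le p T y c" and inj: "inj_on \<psi> S" and sub: "\<psi> ` S \<subseteq> T"
    and dom: "\<And>i. i \<in> S \<Longrightarrow> norm (x i) \<le> norm (y (\<psi> i))"
  shows "lp_le p S x c"
proof (cases "p = \<infinity>")
  case True
  have "norm (x i) \<le> c" if "i \<in> S" for i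
  proof -
    have "norm (y (\<psi> i)) \<le> c" using y sub that True unfolding lp_le_def by auto
    then show ?thesis using dom[OF that] by linarith
  qed
  then show ?thesis using True by (simp add: lp_le_def)
next
  case False
  have "(\<Sum>i\<in>F. norm (x i) powr enn2real p) \<le> c powr enn2real p"
    if F: "finite F" "F \<subseteq> S" for F
  proof -
    have "(\<Sum>i\<in>F. norm (x i) powr enn2real p) \<le> (\<Sum>i\<in>F. norm (y (\<psi> i)) powr enn2real p)"
      using F dom by (intro sum_mono powr_mono2) auto
    also have "\<dots> = (\<Sum>i\<in>\<psi> ` F. norm (y i) powr enn2real p)"
      using inj_on_subset[OF inj F(2)] by (simp add: sum.reindex)
    also have "\<dots> \<le> c powr enn2real p"
    proof -
      have "finite (\<psi> ` F)" "\<psi> ` F \<subseteq> T" using F sub by auto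
      then show ?thesis using y False unfolding lp_le_def by (simp only: if_False)
    qed
    finally show ?thesis .
  qed
  then show ?thesis using False by (simp add: lp_le_def)
qed

lemma lp_le_subset: "lp_le p T x c \<Longrightarrow> S \<subseteq> T \<Longrightarrow> lp_le p S x c"
  by (erule lp_le_dominated[where \<psi> = id]) auto

lemma lp_le_extend_zero:
  assumes S: "lp_le p S x c" and z: "\<And>i. i \<in> T - S \<Longrightarrow> x i = 0" and c: "0 \<le> c"
  shows "lp_le p T x c"
proof (cases "p = \<infinity>")
  case True
  then have "norm (x i) \<le> c" if "i \<in> T" for i
    using S z[of i] c that by (cases "i \<in> S") (auto simp: lp_le_def)
  then show ?thesis using True by (simp add: lp_le_def)
next
  case False
  have "(\<Sum>i\<in>F. norm (x i) powr enn2real p) \<le> c powr enn2real p" if F: "finite F" "F \<subseteq> T" for F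
  proof -
    have "(\<Sum>i\<in>F. norm (x i) powr enn2real p) = (\<Sum>i\<in>F \<inter> S. norm (x i) powr enn2real p)"
      using F z by (intro sum.mono_neutral_right) auto
    also have "\<dots> \<le> c powr enn2real p"
      using S F False by (auto simp: lp_le_def)
    finally show ?thesis .
  qed
  then show ?thesis using False by (simp add: lp_le_def)
qed

lemma lp_le_reindex:
  assumes "inj_on \<psi> S"
  shows "lp_le p S (\<lambda>i. x (\<psi> i)) c \<longleftrightarrow> lp_le p (\<psi> ` S) x c"
proof
  assume "lp_le p S (\<lambda>i. x (\<psi> i)) c"
  then show "lp_le p (\<psi> ` S) x c"
    by (rule lp_le_dominated[where \<psi> = "inv_into S \<psi>"])
      (use assms in \<open>auto simp: inj_on_inv_into inv_into_into f_inv_into_f\<close>)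
next
  assume "lp_le p (\<psi> ` S) x c"
  then show "lp_le p S (\<lambda>i. x (\<psi> i)) c"
    by (rule lp_le_dominated[where \<psi> = \<psi>]) (use assms in auto)
qed

lemma lp_le_scale:
  assumes x: "lp_le p S x c" and t: "0 \<le> t" and c: "0 \<le> c"
    and z: "\<And>i. i \<in> S \<Longrightarrow> norm (z i) \<le> t * norm (x i)"
  shows "lp_le p S z (t * c)"
proof (cases "p = \<infinity>")
  case True
  have "norm (z i) \<le> t * c" if "i \<in> S" for i
  proof -
    have "norm (x i) \<le> c" using x True that by (auto simp: lp_le_def)
    then show ?thesis using z[OF that] mult_left_mono[OF _ t] order_trans by blast
  qed
  then show ?thesis using True by (simp add: lp_le_def)
next
  case False
  have "(\<Sum>i\<in>F. norm (z i) powr enn2real p) \<le> (t * c) powr enn2real p"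
    if F: "finite F" "F \<subseteq> S" for F
  proof -
    have "(\<Sum>i\<in>F. norm (z i) powr enn2real p) \<le> (\<Sum>i\<in>F. t powr enn2real p * norm (x i) powr enn2real p)"
    proof (rule sum_mono)
      fix i assume "i \<in> F"
      then have "norm (z i) powr enn2real p \<le> (t * norm (x i)) powr enn2real p"
        using z F by (intro powr_mono2) auto
      then show "norm (z i) powr enn2real p \<le> t powr enn2real p * norm (x i) powr enn2real p"
        using t by (simp add: powr_mult)
    qed
    also have "\<dots> \<le> t powr enn2real p * c powr enn2real p"
      unfolding sum_distrib_left[symmetric] using x F False
      by (intro mult_left_mono) (auto simp: lp_le_def)
    finally show ?thesis using t c by (simp add: powr_mult)
  qed
  then show ?thesis using False by (simp add: lp_le_def)
qed

text \<open>
  The end point \<open>0\<close>, where \<open>powr\<close> has no second derivative to argue with, is treated by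
  \<open>t powr e \<le> t\<close> for \<open>t \<le> 1\<close>.
\<close>

lemma powr_convex_combination:
  fixes x y a b e :: real
  assumes "1 \<le> e" "0 \<le> x" "0 \<le> y" "0 \<le> a" "0 \<le> b" "a + b = 1"
  shows "(a * x + b * y) powr e \<le> a * x powr e + b * y powr e"
proof -
  have shrink: "(t * z) powr e \<le> t * z powr e" if "0 \<le> t" "t \<le> 1" "0 \<le> z" for t z :: real
  proof -
    have "t powr e \<le> t"
      using that assms(1) powr_mono'[of 1 e t] by simp
    then show ?thesis using that by (simp add: powr_mult mult_right_mono)
  qed
  show ?thesis
  proof (cases "x = 0 \<or> y = 0")
    case True
    then show ?thesis using shrink[of a x] shrink[of b y] assms by auto
  next
    case False
    then show ?thesis
      using powr_convex[OF assms(1)] assms unfolding convex_on_def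
      by (auto simp: less_le)
  qed
qed

text \<open>
  Balls of the sequence norms are convex. This takes the place of the triangle inequality:
  whenever a sum of two families is estimated below, the sum of their norms is known in advance,
  so the sum can be read as a convex combination of two families of equal norm.
\<close>

lemma lp_le_convex_combination:
  assumes p: "1 \<le> p" and ab: "0 \<le> a" "0 \<le> b" "a + b = 1" 
    and x: "lp_le p S x c" and y: "lp_le p S y c"
    and z: "\<And>i. i \<in> S \<Longrightarrow> norm (z i) \<le> a * norm (x i) + b * norm (y i)"
  shows "lp_le p S z c"
proof (cases "p = \<infinity>")
  case True
  have "norm (z i) \<le> c" if i: "i \<in> S" for i
  proof -
    have "norm (x i) \<le> c" "norm (y i) \<le> c" using x y True i by (auto simp: lp_le_def)
    then have "a * norm (x i) + b * norm (y i) \<le> a * c + b * c"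
      using ab by (intro add_mono mult_left_mono) auto
    then have "norm (z i) \<le> a * c + b * c" using z[OF i] by linarith
    then show ?thesis using ab by (simp flip: distrib_right)
  qed
  then show ?thesis using True by (simp add: lp_le_def)
next
  case False
  define e where "e = enn2real p"
  have e: "1 \<le> e" unfolding e_def by (rule enn2real_ge_1[OF p False])
  have "(\<Sum>i\<in>F. norm (z i) powr e) \<le> c powr e" if F: "finite F" "F \<subseteq> S" for F
  proof -
    have "(\<Sum>i\<in>F. norm (z i) powr e) \<le> (\<Sum>i\<in>F. a * norm (x i) powr e + b * norm (y i) powr e)"
    proof (rule sum_mono)
      fix i assume "i \<in> F"
      then have "norm (z i) powr e \<le> (a * norm (x i) + b * norm (y i)) powr e"
        using z F e by (intro powr_mono2) auto
      also have "\<dots> \<le> a * norm (x i) powr e + b * norm (y i) powr e"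
        using e ab by (intro powr_convex_combination) auto
      finally show "norm (z i) powr e \<le> a * norm (x i) powr e + b * norm (y i) powr e" .
    qed
    also have "\<dots> = a * (\<Sum>i\<in>F. norm (x i) powr e) + b * (\<Sum>i\<in>F. norm (y i) powr e)"
      by (simp add: sum.distrib sum_distrib_left)
    also have "\<dots> \<le> a * c powr e + b * c powr e"
      using x y F ab False by (intro add_mono mult_left_mono) (auto simp: lp_le_def e_def)
    also have "\<dots> = c powr e" using ab by (simp flip: distrib_right)
    finally show ?thesis .
  qed
  then show ?thesis using False by (simp add: lp_le_def e_def)
qed

lemma lp_finite_finite: "finite S \<Longrightarrow> lp_finite p S x"
  by (simp add: lp_finite_def)

lemma lp_finite_finite_support:
  assumes "finite S" "\<And>j. j \<notin> S \<Longrightarrow> x j = 0" "1 \<le> p"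
  shows "lp_finite p UNIV x"
proof -
  have fin: "lp_finite p S x" by (rule lp_finite_finite[OF assms(1)])
  then have "lp_le p S x (lp_norm p S x)" by (simp add: lp_le_iff assms(3) lp_norm_nonneg)
  then have "lp_le p UNIV x (lp_norm p S x)"
    by (rule lp_le_extend_zero) (use assms(2) lp_norm_nonneg[OF fin] in auto)
  then show ?thesis using lp_norm_nonneg[OF fin] by (simp add: lp_le_iff assms(3))
qed

lemma lp_finite_diff:
  assumes p: "1 \<le> p" and x: "lp_finite p S x" and y: "lp_finite p S y"
  shows "lp_finite p S (\<lambda>i. x i - y i)"
proof -
  define c where "c = max (lp_norm p S x) (lp_norm p S y)"
  have c: "0 \<le> c" using lp_norm_nonneg[OF x] by (simp add: c_def)
  have "lp_le p S x c" "lp_le p S y c" using x y c p by (auto simp: lp_le_iff c_def)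
  then have "lp_le p S (\<lambda>i. 2 *\<^sub>R x i) (2 * c)" "lp_le p S (\<lambda>i. 2 *\<^sub>R y i) (2 * c)"
    using c by (auto intro: lp_le_scale)
  then have "lp_le p S (\<lambda>i. x i - y i) (2 * c)"
    by (rule lp_le_convex_combination[OF p, of "1/2" "1/2", rotated 3])
      (auto simp: norm_triangle_ineq4)
  then show ?thesis using c p by (simp add: lp_le_iff)
qed

section \<open>Hoelder's inequality and its converse\<close>

lemma inverse_inverse_ennreal: "inverse (inverse (x::ennreal)) = x"
proof (cases x)
  case (real r)
  then show ?thesis by (cases "r = 0") (auto simp: inverse_ennreal)
qed simp

lemma one_le_ennreal_iff_inverse: "1 \<le> (x::ennreal) \<longleftrightarrow> inverse x \<le> 1"
proof (cases x)
  case (real r)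
  then show ?thesis
    by (cases "r = 0") (auto simp: inverse_ennreal ennreal_le_1 ennreal_ge_1 top_unique field_simps)
qed simp

text \<open>
  The exponent relation is between reciprocals of extended numbers, whereas the proofs of the
  inequalities need it between real numbers, or in the form of an equation between two exponents
  when one of them is infinite.
\<close>

locale hoelder_exponents =
  fixes \<tau> \<rho> \<rho>' :: ennreal
  assumes tau_ge_1: "1 \<le> \<tau>" and tau_le_rho: "\<tau> \<le> \<rho>"
    and reciprocals: "inverse \<rho> + inverse \<rho>' = inverse \<tau>"
begin

lemma rho_ge_1: "1 \<le> \<rho>"
  using tau_ge_1 tau_le_rho by simp

lemma rho'_ge_1: "1 \<le> \<rho>'"
proof -
  have "inverse \<rho>' \<le> inverse \<tau>" unfolding reciprocals[symmetric] by simp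
  then show ?thesis using tau_ge_1 unfolding one_le_ennreal_iff_inverse by (rule order_trans)
qed

lemma reciprocals_real: "1 / enn2real \<rho> + 1 / enn2real \<rho>' = 1 / enn2real \<tau>"
proof -
  have recip: "enn2real (inverse p) = 1 / enn2real p" for p
  proof (cases p)
    case (real r)
    then show ?thesis by (cases "r = 0") (auto simp: inverse_ennreal inverse_eq_divide)
  qed simp
  have "inverse \<rho> < top" "inverse \<rho>' < top"
    using rho_ge_1 rho'_ge_1 by (auto simp: less_top[symmetric])
  then have "enn2real (inverse \<tau>) = enn2real (inverse \<rho>) + enn2real (inverse \<rho>')"
    unfolding reciprocals[symmetric] by (simp add: enn2real_plus)
  then show ?thesis by (simp add: recip)
qed

lemma tau_infinite: "\<tau> = \<infinity> \<Longrightarrow> \<rho> = \<infinity> \<and> \<rho>' = \<infinity>"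
  using reciprocals by auto

lemma rho_infinite: "\<rho> = \<infinity> \<Longrightarrow> \<rho>' = \<tau>"
  using reciprocals by (metis add_0 ennreal_inverse_top infinity_ennreal_def inverse_inverse_ennreal)

lemma rho'_infinite: "\<rho>' = \<infinity> \<Longrightarrow> \<rho> = \<tau>"
  using reciprocals by (metis add_0_right ennreal_inverse_top infinity_ennreal_def inverse_inverse_ennreal)

text \<open>
  Hoelder's inequality, in the form that bounds the \<open>\<tau>\<close>-norm of a product. When all exponents are
  finite, Young's inequality with the weights \<open>\<tau>/\<rho>\<close> and \<open>\<tau>/\<rho>'\<close>, whose sum is \<open>1\<close>, is applied to the
  factors normalised by \<open>c\<close> and \<open>d\<close>. If a factor is only bounded, it is pulled out of the sum.
\<close>

lemma hoelder:
  assumes x: "lp_le \<rho> S x c" and y: "lp_le \<rho>' S y d" and c: "0 \<le> c" and d: "0 \<le> d"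
    and z: "\<And>i. i \<in> S \<Longrightarrow> norm (z i) \<le> norm (x i) * norm (y i)"
  shows "lp_le \<tau> S z (c * d)"
proof -
  consider "\<rho> = \<infinity>" "\<rho>' = \<infinity>" "\<tau> = \<infinity>" | "\<rho> = \<infinity>" "\<rho>' = \<tau>" "\<tau> \<noteq> \<infinity>"
    | "\<rho>' = \<infinity>" "\<rho> = \<tau>" "\<tau> \<noteq> \<infinity>" | "\<rho> \<noteq> \<infinity>" "\<rho>' \<noteq> \<infinity>" "\<tau> \<noteq> \<infinity>"
    using rho_infinite rho'_infinite tau_infinite by metis
  then show ?thesis
  proof cases
    case 1
    have "norm (z i) \<le> c * d" if "i \<in> S" for i
    proof -
      have "norm (x i) * norm (y i) \<le> c * d"
        using x y c that 1 by (intro mult_mono) (auto simp: lp_le_def)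
      then show ?thesis using z[OF that] by linarith
    qed
    then show ?thesis using 1 by (simp add: lp_le_def)
  next
    case 2
    show ?thesis unfolding lp_le_def
    proof (simp only: 2 if_False, intro allI impI)
      fix F assume F: "finite F" "F \<subseteq> S"
      have "(\<Sum>i\<in>F. norm (z i) powr enn2real \<tau>) \<le> (\<Sum>i\<in>F. c powr enn2real \<tau> * norm (y i) powr enn2real \<tau>)"
      proof (rule sum_mono)
        fix i assume i: "i \<in> F"
        then have "norm (x i) \<le> c" using x 2 F by (auto simp: lp_le_def)
        then have "norm (z i) \<le> c * norm (y i)"
          using z[of i] i F mult_right_mono[of "norm (x i)" c "norm (y i)"] by force
        then show "norm (z i) powr enn2real \<tau> \<le> c powr enn2real \<tau> * norm (y i) powr enn2real \<tau>"
          using c by (simp flip: powr_mult add: powr_mono2)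
      qed
      also have "\<dots> \<le> c powr enn2real \<tau> * d powr enn2real \<tau>"
        unfolding sum_distrib_left[symmetric] using y 2 F by (intro mult_left_mono) (auto simp: lp_le_def)
      finally show "(\<Sum>i\<in>F. norm (z i) powr enn2real \<tau>) \<le> (c * d) powr enn2real \<tau>"
        using c d by (simp add: powr_mult)
    qed
  next
    case 3
    show ?thesis unfolding lp_le_def
    proof (simp only: 3 if_False, intro allI impI)
      fix F assume F: "finite F" "F \<subseteq> S"
      have "(\<Sum>i\<in>F. norm (z i) powr enn2real \<tau>) \<le> (\<Sum>i\<in>F. norm (x i) powr enn2real \<tau> * d powr enn2real \<tau>)"
      proof (rule sum_mono)
        fix i assume i: "i \<in> F"
        then have "norm (y i) \<le> d" using y 3 F by (auto simp: lp_le_def)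
        then have "norm (z i) \<le> norm (x i) * d"
          using z[of i] i F mult_left_mono[of "norm (y i)" d "norm (x i)"] by force
        then show "norm (z i) powr enn2real \<tau> \<le> norm (x i) powr enn2real \<tau> * d powr enn2real \<tau>"
          using d by (simp flip: powr_mult add: powr_mono2)
      qed
      also have "\<dots> \<le> c powr enn2real \<tau> * d powr enn2real \<tau>"
        unfolding sum_distrib_right[symmetric] using x 3 F by (intro mult_right_mono) (auto simp: lp_le_def)
      finally show "(\<Sum>i\<in>F. norm (z i) powr enn2real \<tau>) \<le> (c * d) powr enn2real \<tau>"
        using c d by (simp add: powr_mult)
    qed
  next
    case 4
    define a b t where "a = enn2real \<rho>" and "b = enn2real \<rho>'" and "t = enn2real \<tau>"
    have pos: "1 \<le> a" "1 \<le> b" "1 \<le> t" and recip: "1/a + 1/b = 1/t"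
      using 4 enn2real_ge_1 rho_ge_1 rho'_ge_1 tau_ge_1 reciprocals_real by (auto simp: a_def b_def t_def)
    have weights: "t / a + t / b = 1" 
    proof -
      have "t * (1 / a + 1 / b) = t * (1 / t)" by (simp only: recip)
      then show ?thesis using pos by (simp add: distrib_left)
    qed
    have young: "(u * v) powr t \<le> t / a * u powr a + t / b * v powr b" if "0 \<le> u" "0 \<le> v" for u v
    proof (cases "u = 0 \<or> v = 0")
      case False
      then have "(u powr a) powr (t / a) * (v powr b) powr (t / b) \<le> t / a * u powr a + t / b * v powr b"
        using that pos weights by (intro Youngs_inequality_0) auto
      then show ?thesis using that pos by (simp add: powr_powr powr_mult)
    qed (use pos in auto)
    show ?thesis unfolding lp_le_def
    proof (simp only: 4 if_False, intro allI impI)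
      fix F assume F: "finite F" "F \<subseteq> S"
      have X: "(\<Sum>i\<in>F. norm (x i) powr a) \<le> c powr a" and Y: "(\<Sum>i\<in>F. norm (y i) powr b) \<le> d powr b"
        using x y F 4 by (auto simp: lp_le_def a_def b_def)
      show "(\<Sum>i\<in>F. norm (z i) powr enn2real \<tau>) \<le> (c * d) powr enn2real \<tau>"
      proof (cases "c = 0 \<or> d = 0")
        case True
        have "norm (z i) = 0" if i: "i \<in> F" for i
        proof -
          have "norm (x i) powr a \<le> c powr a" "norm (y i) powr b \<le> d powr b"
            using X Y member_le_sum[OF i, of "\<lambda>i. norm (x i) powr a"]
              member_le_sum[OF i, of "\<lambda>i. norm (y i) powr b"] F by auto
          then have "norm (x i) * norm (y i) = 0" using True by auto
          then show ?thesis using z[of i] i F by (metis norm_ge_zero order_antisym subsetD)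
        qed
        then show ?thesis by simp
      next
        case False
        then have cd: "0 < c" "0 < d" using c d by auto
        have "norm (z i) powr t \<le> (c * d) powr t * (t / a * (norm (x i) powr a / c powr a) + t / b * (norm (y i) powr b / d powr b))"
          if i: "i \<in> F" for i
        proof -
          have "norm (z i) powr t \<le> (norm (x i) * norm (y i)) powr t"
            using z[of i] i F pos by (intro powr_mono2) auto
          also have "\<dots> = (c * d) powr t * (norm (x i) / c * (norm (y i) / d)) powr t"
            using cd by (simp flip: powr_mult)
          also have "\<dots> \<le> (c * d) powr t * (t / a * (norm (x i) / c) powr a + t / b * (norm (y i) / d) powr b)"
            using cd by (intro mult_left_mono young) auto
          finally show ?thesis using cd by (simp add: powr_divide)
        qed
        then have "(\<Sum>i\<in>F. norm (z i) powr t) \<le> (\<Sum>i\<in>F. (c * d) powr t * (t / a * (norm (x i) powr a / c powr a) + t / b * (norm (y i) powr b / d powr b)))"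
          by (rule sum_mono)
        also have "\<dots> = (c * d) powr t * (t / a * ((\<Sum>i\<in>F. norm (x i) powr a) / c powr a) + t / b * ((\<Sum>i\<in>F. norm (y i) powr b) / d powr b))"
          by (simp add: sum_distrib_left sum.distrib sum_divide_distrib distrib_left)
        also have "\<dots> \<le> (c * d) powr t * (t / a * 1 + t / b * 1)"
          using X Y cd pos by (intro mult_left_mono add_mono) auto
        also have "\<dots> = (c * d) powr t" using weights by simp
        finally show ?thesis by (simp add: t_def)
      qed
    qed
  qed
qed

text \<open>
  Duality: the \<open>\<rho>'\<close>-norm of the weights is attained by testing them against finitely supported
  families of \<open>\<rho>\<close>-norm \<open>c\<close>. The equality case of Hoelder's inequality prescribes the test family,
  which is proportional to \<open>lam powr (\<rho>'/\<rho>)\<close>; for infinite \<open>\<rho>'\<close> a single spike does it. In the lower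
  bound, the test families are the perturbations that an algorithm cannot see.
\<close>

lemma hoelder_converse:
  fixes lam :: "'i \<Rightarrow> real"
  assumes lam: "\<And>i. i \<in> U \<Longrightarrow> 0 < lam i" and c: "0 < c" and e: "0 \<le> e"
    and test: "\<And>y F. finite F \<Longrightarrow> F \<subseteq> U \<Longrightarrow> (\<And>i. i \<notin> F \<Longrightarrow> y i = (0::real)) \<Longrightarrow> lp_le \<rho> UNIV y c
      \<Longrightarrow> lp_le \<tau> UNIV (\<lambda>i. lam i * y i) e"
  shows "lp_le \<rho>' U lam (e / c)"
proof (cases "\<rho>' = \<infinity>")
  case True
  have "lam j \<le> e / c" if j: "j \<in> U" for j
  proof -
    let ?y = "\<lambda>i. if i = j then c else 0"
    have "lp_le \<rho> {j} ?y c" using c rho_ge_1 by (simp add: lp_le_singleton)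
    then have "lp_le \<rho> UNIV ?y c" using c by (rule_tac lp_le_extend_zero) auto
    then have "lp_le \<tau> UNIV (\<lambda>i. lam i * ?y i) e" using j by (intro test[of "{j}"]) auto
    then have "lp_le \<tau> {j} (\<lambda>i. lam i * ?y i) e" by (rule lp_le_subset) simp
    then show ?thesis using c e lam[OF j] tau_ge_1 by (simp add: lp_le_singleton field_simps)
  qed
  then show ?thesis using True lam by (simp add: lp_le_def less_imp_le)
next
  case False
  then have tau: "\<tau> \<noteq> \<infinity>" using tau_infinite by blast
  define a b t where "a = enn2real \<rho>" and "b = enn2real \<rho>'" and "t = enn2real \<tau>"
  have pos: "1 \<le> b" "1 \<le> t" and recip: "1/a + 1/b = 1/t"
    using False tau enn2real_ge_1 rho'_ge_1 tau_ge_1 reciprocals_real by (auto simp: a_def b_def t_def)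
  show ?thesis unfolding lp_le_def
  proof (simp only: False if_False, intro allI impI)
    fix F assume F: "finite F" "F \<subseteq> U"
    define N where "N = (\<Sum>i\<in>F. lam i powr b)"
    show "(\<Sum>i\<in>F. norm (lam i) powr enn2real \<rho>') \<le> (e / c) powr enn2real \<rho>'"
    proof (cases "F = {}")
      case True
      then show ?thesis by simp
    next
      case F0: False
      have N: "0 < N" 
      proof -
        have "0 < lam i powr b" if "i \<in> F" for i
          using lam[OF subsetD[OF F(2) that]] by simp
        then show ?thesis unfolding N_def using F F0 by (intro sum_pos) auto
      qed
      \<comment> \<open>For infinite \<open>\<rho>\<close> the exponent \<open>1 / a\<close> is \<open>1 / 0 = 0\<close>, and \<open>y\<close> is the constant \<open>c\<close> on \<open>F\<close>,
        which is again the extremal choice.\<close>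
      define y where "y = (\<lambda>i. if i \<in> F then c * (lam i powr b / N) powr (1 / a) else 0)"
      have "lp_le \<rho> F y c"
      proof (cases "\<rho> = \<infinity>")
        case True
        then show ?thesis using c by (auto simp: lp_le_def y_def a_def)
      next
        case rho: False
        then have a: "1 \<le> a" using enn2real_ge_1 rho_ge_1 by (simp add: a_def)
        have "(\<Sum>i\<in>F. norm (y i) powr a) = (\<Sum>i\<in>F. c powr a * (lam i powr b / N))"
        proof (rule sum.cong)
          fix i assume "i \<in> F"
          then show "norm (y i) powr a = c powr a * (lam i powr b / N)"
            using a c N by (simp add: y_def abs_mult powr_mult powr_powr)
        qed simp
        also have "\<dots> = c powr a" using N by (simp add: N_def flip: sum_distrib_left sum_divide_distrib)
        finally show ?thesis using F rho by (simp add: lp_le_finite a_def)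
      qed
      then have "lp_le \<rho> UNIV y c" using c by (rule_tac lp_le_extend_zero) (auto simp: y_def)
      then have "lp_le \<tau> UNIV (\<lambda>i. lam i * y i) e"
        using F by (intro test[of F]) (auto simp: y_def)
      then have *: "(\<Sum>i\<in>F. norm (lam i * y i) powr t) \<le> e powr t"
        using F tau by (auto simp: lp_le_def t_def)
      have "norm (lam i * y i) powr t = c powr t * N powr (- t / a) * lam i powr b" if i: "i \<in> F" for i
      proof -
        have "0 < lam i" using lam F i by auto
        have "t + b * t / a = b"
        proof -
          have "b * t * (1 / a + 1 / b) = b * t * (1 / t)" by (simp only: recip)
          then show ?thesis using pos by (simp add: distrib_left)
        qed
        then have split: "lam i powr b = lam i powr t * lam i powr (b * t / a)" by (metis powr_add)
        have "((lam i powr b / N) powr (1 / a)) powr t = lam i powr (b * t / a) * N powr (- t / a)"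
          using N by (simp add: powr_powr powr_divide powr_minus divide_simps)
        then have "norm (lam i * y i) powr t =
            lam i powr t * (c powr t * (lam i powr (b * t / a) * N powr (- t / a)))"
          using i \<open>0 < lam i\<close> c N by (simp only: y_def if_True real_norm_def abs_mult)
            (simp add: powr_mult)
        then show ?thesis unfolding split by (simp only: ac_simps)
      qed
      then have "(\<Sum>i\<in>F. norm (lam i * y i) powr t) = c powr t * N powr (- t / a) * N"
        by (simp add: N_def sum_distrib_left)
      also have "\<dots> = c powr t * N powr (t / b)"
      proof -
        have "t * (1 / a + 1 / b) = t * (1 / t)" by (simp only: recip)
        then have "- t / a + 1 = t / b" using pos by (simp add: distrib_left)
        then show ?thesis using N by (metis mult.assoc powr_add powr_one less_imp_le)
      qed
      finally have "c powr t * N powr (t / b) \<le> e powr t" using * by simp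
      then have "(c powr t * N powr (t / b)) powr (b / t) \<le> (e powr t) powr (b / t)"
        using pos c N by (intro powr_mono2) auto
      then have "c powr b * N \<le> e powr b"
        using c N pos e by (simp add: powr_mult powr_powr)
      then have "N \<le> (e / c) powr b"
        using c e by (simp add: powr_divide field_simps)
      moreover have "(\<Sum>i\<in>F. norm (lam i) powr b) = N"
        unfolding N_def using lam F by (intro sum.cong) (auto simp: subset_iff less_imp_le)
      ultimately show ?thesis by (simp add: b_def)
    qed
  qed
qed

end

section \<open>What an adaptive algorithm can see\<close>

text \<open>
  The algorithm is deterministic and looks at an input through the sampled coefficients only, so
  an input that agrees with \<open>f\<close> on those is treated in the same way. This is the principle behind
  every lower bound for the number of samples.
\<close>

lemma observed_cong:
  assumes "\<And>j. j \<in> sampled alg \<epsilon> f \<Longrightarrow> g j = f j"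
  shows "observed alg \<epsilon> g m = observed alg \<epsilon> f m"
proof (induction m)
  case (Suc m)
  show ?case
  proof (cases "alg \<epsilon> (observed alg \<epsilon> f m)")
    case (Sample j)
    then have "(j, f j) \<in> set (observed alg \<epsilon> f (Suc m))" by simp
    then have "j \<in> sampled alg \<epsilon> f" unfolding sampled_def by (metis UNIV_I UN_I fst_conv image_eqI)
    then show ?thesis using Suc Sample assms by simp
  qed (use Suc in simp)
qed simp

lemma returns_cong:
  assumes "\<And>j. j \<in> sampled alg \<epsilon> f \<Longrightarrow> g j = f j"
  shows "returns alg \<epsilon> g v \<longleftrightarrow> returns alg \<epsilon> f v"
  unfolding returns_def by (simp add: observed_cong[OF assms])

lemma observed_stable:
  assumes "alg \<epsilon> (observed alg \<epsilon> f m) = Return v" "m \<le> n"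
  shows "observed alg \<epsilon> f n = observed alg \<epsilon> f m"
  using assms(2) by (induction n rule: dec_induct) (simp_all add: assms(1))

lemma returns_unique: "returns alg \<epsilon> f v \<Longrightarrow> returns alg \<epsilon> f w \<Longrightarrow> v = w"
  unfolding returns_def by (metis action.inject(2) nat_le_linear observed_stable)

lemma finite_sampled:
  assumes "returns alg \<epsilon> f v"
  shows "finite (sampled alg \<epsilon> f)"
proof -
  obtain m where m: "alg \<epsilon> (observed alg \<epsilon> f m) = Return v"
    using assms by (auto simp: returns_def)
  have "sampled alg \<epsilon> f = (\<Union>l\<le>m. fst ` set (observed alg \<epsilon> f l))"
    unfolding sampled_def
  proof (intro equalityI UN_least)
    fix l
    have "observed alg \<epsilon> f l = observed alg \<epsilon> f (min l m)"
      using observed_stable[of alg \<epsilon> f m v l] m by (cases "l \<le> m") auto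
    then show "fst ` set (observed alg \<epsilon> f l) \<subseteq> (\<Union>l\<le>m. fst ` set (observed alg \<epsilon> f l))"
      by (metis UN_upper atMost_iff min.cobounded2)
  qed auto
  then show ?thesis by simp
qed

lemma first_n_mono: "(\<And>n. P n \<Longrightarrow> Q n) \<Longrightarrow> first_n Q \<le> first_n P"
  unfolding first_n_def by (intro Inf_superset_mono) auto

lemma first_n_le: "P n \<Longrightarrow> first_n P \<le> enat n"
  unfolding first_n_def by (intro Inf_lower) auto

lemma first_n_least:
  assumes "P n" "\<And>i. i < n \<Longrightarrow> \<not> P i"
  shows "first_n P = enat n"
proof -
  have "n \<le> i" if "P i" for i using assms(2)[of i] that by (meson not_le)
  then show ?thesis unfolding first_n_def using assms(1) by (intro Inf_eqI) auto
qed

lemma first_n_never: "(\<And>n. \<not> P n) \<Longrightarrow> first_n P = \<infinity>"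
  unfolding first_n_def by (simp add: Inf_enat_def)

text \<open>
  As long as the stopping criterion fails, the observed list consists of the first coefficients
  in the order of the enumeration; once it holds, the list no longer changes. The sampled
  wavenumbers are therefore those before the first stop, which covers the case of no stop as well.
\<close>

lemma sampled_cone_alg:
  fixes f :: "'k \<Rightarrow> 'a::{real_normed_field,banach}"
    and k :: "nat \<Rightarrow> 'k" and lam :: "'k \<Rightarrow> real" and \<rho> \<rho>' :: ennreal and n1 :: nat and A \<epsilon> :: real
  defines "stop \<equiv> \<lambda>l. n1 \<le> l \<and> ERR \<rho> \<rho>' lam k n1 A f l \<le> \<epsilon>"
  shows "sampled (cone_alg \<rho> \<rho>' lam k n1 A) \<epsilon> f = k ` {i. 1 \<le> i \<and> (\<forall>l<i. \<not> stop l)}"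
proof -
  let ?alg = "cone_alg \<rho> \<rho>' lam k n1 A"
  define hist where "hist n = map (\<lambda>i. (k i, f (k i))) [1..<Suc n]" for n
  have step: "?alg \<epsilon> (hist n) = (if stop n then Return (APP k f n) else Sample (k (n + 1)))" for n
  proof -
    have "ERR \<rho> \<rho>' lam k n1 A (APP k f n) n = ERR \<rho> \<rho>' lam k n1 A f n" if "n1 \<le> n"
      using that by (intro ERR_cong) (auto simp: APP_def)
    moreover have "APP k (APP k f n) n = APP k f n" "length (hist n) = n"
      by (auto simp: APP_def hist_def)
    moreover have "known (hist n) = APP k f n" unfolding hist_def by (rule known_samples)
    ultimately show ?thesis unfolding cone_alg_def Let_def stop_def by auto
  qed
  \<comment> \<open>Either all \<open>m\<close> steps have been spent on sampling, or sampling has stopped at \<open>l\<close>.\<close>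
  have obs: "\<exists>l\<le>m. observed ?alg \<epsilon> f m = hist l \<and> (\<forall>i<l. \<not> stop i) \<and> (l = m \<or> stop l)" for m
  proof (induction m)
    case 0
    then show ?case by (auto simp: hist_def)
  next
    case (Suc m)
    then obtain l where l: "l \<le> m" "observed ?alg \<epsilon> f m = hist l" "\<forall>i<l. \<not> stop i" "l = m \<or> stop l"
      by blast
    show ?case
    proof (cases "stop l")
      case True
      then show ?thesis using l by (intro exI[of _ l]) (auto simp: step)
    next
      case False
      then have "observed ?alg \<epsilon> f (Suc m) = hist (Suc m)"
        using l by (simp add: step) (simp add: hist_def)
      then show ?thesis using l False by (intro exI[of _ "Suc m"]) (auto simp: less_Suc_eq)
    qed
  qed
  have fst_hist: "fst ` set (hist l) = k ` {1..l}" for l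
    by (auto simp: hist_def image_image simp del: upt_Suc)
  show ?thesis
  proof (intro equalityI subsetI)
    fix j assume "j \<in> sampled ?alg \<epsilon> f"
    then obtain m where "j \<in> fst ` set (observed ?alg \<epsilon> f m)" by (auto simp: sampled_def)
    then obtain l where "j \<in> k ` {1..l}" "\<forall>i<l. \<not> stop i" using obs[of m] fst_hist by metis
    then show "j \<in> k ` {i. 1 \<le> i \<and> (\<forall>l<i. \<not> stop l)}" by auto
  next
    fix j assume "j \<in> k ` {i. 1 \<le> i \<and> (\<forall>l<i. \<not> stop l)}"
    then obtain i where i: "j = k i" "1 \<le> i" "\<forall>l<i. \<not> stop l" by auto
    obtain l where l: "l \<le> i" "observed ?alg \<epsilon> f i = hist l" "l = i \<or> stop l" using obs[of i] by blast
    then have "l = i" using i(3) by (auto simp: less_le)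
    then have "j \<in> fst ` set (observed ?alg \<epsilon> f i)" using l i fst_hist by auto
    then show "j \<in> sampled ?alg \<epsilon> f" by (auto simp: sampled_def)
  qed
qed

lemma cost_cone_alg:
  assumes inj: "inj_on k {1..}"
  shows "cost (cone_alg \<rho> \<rho>' lam k n1 A) f \<epsilon> = first_n (\<lambda>l. n1 \<le> l \<and> ERR \<rho> \<rho>' lam k n1 A f l \<le> \<epsilon>)"
proof -
  define stop where "stop l \<longleftrightarrow> n1 \<le> l \<and> ERR \<rho> \<rho>' lam k n1 A f l \<le> \<epsilon>" for l
  define I where "I = {i. 1 \<le> i \<and> (\<forall>l<i. \<not> stop l)}"
  have S: "sampled (cone_alg \<rho> \<rho>' lam k n1 A) \<epsilon> f = k ` I"
    unfolding sampled_cone_alg I_def stop_def ..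
  have injI: "inj_on k I" using inj by (rule inj_on_subset) (auto simp: I_def)
  have "cost (cone_alg \<rho> \<rho>' lam k n1 A) f \<epsilon> = first_n stop"
  proof (cases "\<exists>n. stop n")
    case True
    then obtain n where n: "stop n" "\<And>i. i < n \<Longrightarrow> \<not> stop i" by (metis exists_least_iff)
    have "I = {1..n}" unfolding I_def using n by (auto simp: not_less[symmetric])
    then show ?thesis using n injI by (simp add: cost_def S card_image first_n_least)
  next
    case False
    then have "I = {1..}" by (auto simp: I_def)
    then have "infinite (k ` I)" using injI infinite_Ici by (simp add: finite_image_iff)
    then show ?thesis using False by (simp add: cost_def S first_n_never)
  qed
  then show ?thesis by (simp only: stop_def[abs_def])
qed

section \<open>Heads and tails of the weight sequence\<close>

text \<open>
  The factor \<open>lam j\<close> makes \<open>c\<close> the norm of the spike in the input space.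
\<close>

definition spike :: "('k \<Rightarrow> real) \<Rightarrow> 'k \<Rightarrow> real \<Rightarrow> 'k \<Rightarrow> 'a::{real_normed_field,banach}" where
  "spike lam j c = (\<lambda>i. if i = j then of_real (c * lam j) else 0)"

locale cone_problem = hoelder_exponents \<tau> \<rho> \<rho>'
  for \<tau> \<rho> \<rho>' :: ennreal +
  fixes lam :: "'k \<Rightarrow> real" and k :: "nat \<Rightarrow> 'k" and n1 :: nat and A :: real
  assumes enumeration: "bij_betw k {1..} (UNIV :: 'k set)"
    and weights_pos: "0 < lam j"
    and weights_decreasing: "1 \<le> i \<Longrightarrow> lam (k (i + 1)) \<le> lam (k i)"
    and weights_finite: "lp_finite \<rho>' UNIV lam"
    and n1: "1 \<le> n1"
    and A: "1 < A"
begin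

abbreviation head :: "('k \<Rightarrow> 'a::{real_normed_field,banach}) \<Rightarrow> nat \<Rightarrow> real" where
  "head \<equiv> head_norm \<rho> lam k"

abbreviation tail :: "nat \<Rightarrow> real" where
  "tail \<equiv> tail_norm \<rho>' lam k"

abbreviation cone :: "('k \<Rightarrow> 'a::{real_normed_field,banach}) set" where
  "cone \<equiv> data_cone \<rho> lam k n1 A"

lemma inj_k: "inj_on k {1..}"
  using enumeration by (rule bij_betw_imp_inj_on)

lemma inj_k_subset: "S \<subseteq> {1..} \<Longrightarrow> inj_on k S"
  by (rule inj_on_subset[OF inj_k])

lemma image_tail: "k ` {n + 1..} = - k ` {1..n}"
proof -
  have "k ` {n + 1..} = k ` ({1..} - {1..n})" by (rule arg_cong) auto
  also have "\<dots> = k ` {1..} - k ` {1..n}" by (intro inj_on_image_set_diff[OF inj_k]) auto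
  also have "k ` {1..} = UNIV" using enumeration by (simp add: bij_betw_def)
  finally show ?thesis by auto
qed

lemma not_in_head: "j \<notin> k ` {1..n} \<Longrightarrow> \<exists>i>n. j = k i"
  by (metis ComplI Suc_eq_plus1 Suc_le_lessD atLeast_iff image_iff image_tail)

lemma weights_antimono: "1 \<le> i \<Longrightarrow> i \<le> j \<Longrightarrow> lam (k j) \<le> lam (k i)"
proof (induction j)
  case (Suc j)
  then show ?case using weights_decreasing[of j] by (cases "i = Suc j") auto
qed simp

lemma head_le_iff: "0 \<le> c \<Longrightarrow> head f n \<le> c \<longleftrightarrow> lp_le \<rho> (k ` {1..n}) (weighted lam f) c"
  unfolding head_norm_def using lp_le_reindex[of k "{1..n}" \<rho> "weighted lam f" c]
    lp_le_iff[OF rho_ge_1, of c "{1..n}" "\<lambda>i. weighted lam f (k i)"] inj_k_subset[of "{1..n}"]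
  by (simp add: lp_finite_finite subset_iff)

lemma head_nonneg: "0 \<le> head f n"
  unfolding head_norm_def by (intro lp_norm_nonneg lp_finite_finite) simp

lemma head_powr:
  assumes "\<rho> \<noteq> \<infinity>"
  shows "head f n powr enn2real \<rho> = (\<Sum>j\<in>k ` {1..n}. norm (weighted lam f j) powr enn2real \<rho>)"
proof -
  have "1 \<le> enn2real \<rho>" using enn2real_ge_1[OF rho_ge_1 assms] .
  moreover have "(\<Sum>j\<in>k ` {1..n}. norm (weighted lam f j) powr enn2real \<rho>)
      = (\<Sum>i=1..n. norm (weighted lam f (k i)) powr enn2real \<rho>)"
    using inj_k_subset[of "{1..n}"] by (simp add: sum.reindex subset_iff)
  moreover have "0 \<le> (\<Sum>i=1..n. norm (weighted lam f (k i)) powr enn2real \<rho>)" by (intro sum_nonneg) auto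
  ultimately show ?thesis using assms by (simp add: head_norm_def lp_norm_def powr_powr)
qed

lemma lp_finite_tail: "lp_finite \<rho>' {n + 1..} (\<lambda>i. lam (k i))"
proof -
  have nn: "0 \<le> lp_norm \<rho>' UNIV lam" by (rule lp_norm_nonneg[OF weights_finite])
  then have "lp_le \<rho>' UNIV lam (lp_norm \<rho>' UNIV lam)"
    using weights_finite by (simp add: lp_le_iff[OF rho'_ge_1])
  then have "lp_le \<rho>' (k ` {n + 1..}) lam (lp_norm \<rho>' UNIV lam)" by (rule lp_le_subset) simp
  then show ?thesis
    using lp_le_reindex[OF inj_k_subset, of "{n + 1..}" \<rho>' lam] lp_le_iff[OF rho'_ge_1 nn, of "{n + 1..}"]
    by auto
qed

lemma tail_le_iff: "0 \<le> c \<Longrightarrow> tail n \<le> c \<longleftrightarrow> lp_le \<rho>' (- k ` {1..n}) lam c"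
  unfolding tail_norm_def image_tail[symmetric]
  using lp_le_reindex[OF inj_k_subset, of "{n + 1..}" \<rho>' lam c] lp_finite_tail[of n]
    lp_le_iff[OF rho'_ge_1, of c "{n + 1..}" "\<lambda>i. lam (k i)"] by auto

lemma tail_nonneg: "0 \<le> tail n"
  unfolding tail_norm_def by (rule lp_norm_nonneg[OF lp_finite_tail])

lemma tail_antimono: "m \<le> n \<Longrightarrow> tail n \<le> tail m"
  using tail_le_iff[OF tail_nonneg, of m m]
  by (subst tail_le_iff[OF tail_nonneg]) (auto elim!: lp_le_subset)

lemma tail_pos: "0 < tail n"
proof -
  have "lp_le \<rho>' (k ` {n + 1..}) lam (tail n)"
    using tail_le_iff[OF tail_nonneg, of n n] image_tail by simp
  then have "lp_le \<rho>' {k (n + 1)} lam (tail n)" by (rule lp_le_subset) auto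
  then show ?thesis using weights_pos[of "k (n + 1)"] 
    by (simp add: lp_le_singleton[OF rho'_ge_1 tail_nonneg])
qed

text \<open>
  For finite \<open>\<rho>'\<close> the tails of a convergent series vanish. For infinite \<open>\<rho>'\<close>, that is \<open>\<tau> = \<rho>\<close>, the tail
  norm is the supremum of the remaining weights, which vanishes only if the weights do.
\<close>

lemma tail_eventually_small:
  assumes "\<rho>' \<noteq> \<infinity> \<or> (\<lambda>i. lam (k i)) \<longlonglongrightarrow> 0" and t: "0 < t"
  shows "\<exists>n\<ge>n1. tail n \<le> t"
proof -
  have "\<exists>n. tail n \<le> t"
  proof (cases "\<rho>' = \<infinity>")
    case True
    then have "eventually (\<lambda>i. lam (k i) < t) sequentially"
      using assms order_tendstoD(2) by blast
    then obtain n where n: "\<And>i. n \<le> i \<Longrightarrow> lam (k i) < t" by (auto simp: eventually_sequentially)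
    have "lam j \<le> t" if "j \<notin> k ` {1..n}" for j
      using not_in_head[OF that] n by (auto intro: less_imp_le)
    then have "lp_le \<rho>' (- k ` {1..n}) lam t"
      using True weights_pos by (auto simp: lp_le_def less_imp_le)
    then show ?thesis using t tail_le_iff[of t n] by auto
  next
    case False
    define b where "b = enn2real \<rho>'"
    let ?g = "\<lambda>j. norm (lam j) powr b"
    have sm: "?g summable_on UNIV" using weights_finite False by (simp add: lp_finite_def b_def)
    obtain F where F: "finite F" "dist (sum ?g F) (infsum ?g UNIV) \<le> t powr b"
      using infsum_finite_approximation[OF sm, of "t powr b"] t by auto
    have "F \<subseteq> k ` {1..}" using enumeration by (simp add: bij_betw_def)
    then obtain I where I: "I \<subseteq> {1..}" "finite I" "F = k ` I" using finite_subset_image[OF F(1)] by metis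
    then obtain n where "I \<subseteq> {..n}" using finite_nat_iff_bounded_le by auto
    then have Fn: "F \<subseteq> k ` {1..n}" using I by fastforce
    have "(\<Sum>j\<in>G. ?g j) \<le> t powr b" if G: "finite G" "G \<subseteq> - k ` {1..n}" for G
    proof -
      have "sum ?g F + sum ?g G = sum ?g (F \<union> G)"
        using F G Fn by (intro sum.union_disjoint[symmetric]) auto
      also have "\<dots> \<le> infsum ?g UNIV" using F G by (intro finite_sum_le_infsum sm) auto
      also have "\<dots> \<le> sum ?g F + t powr b" using F(2) by (simp add: dist_real_def)
      finally show ?thesis by simp
    qed
    then have "lp_le \<rho>' (- k ` {1..n}) lam t" using False by (simp add: lp_le_def b_def)
    then show ?thesis using t tail_le_iff[of t n] by auto
  qed
  then obtain n where "tail n \<le> t" by blast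
  then have "tail (max n n1) \<le> t" using tail_antimono[of n "max n n1"] by simp
  then show ?thesis by (metis max.cobounded2)
qed

text \<open>
  Among all choices of \<open>m\<close> wavenumbers, removing the first \<open>m\<close> leaves the smallest norm, since the
  weights decrease: every removed wavenumber beyond the first \<open>m\<close> is exchanged, injectively, for one
  of the first \<open>m\<close> that has not been removed and has at least the same weight.
\<close>

lemma lp_le_weights_outside:
  assumes S: "finite S" "card S \<le> m" and le: "lp_le p (- S) lam c"
  shows "lp_le p (- k ` {1..m}) lam c"
proof -
  define K where "K = k ` {1..m}"
  have K: "finite K" "card K = m"
    using inj_k_subset[of "{1..m}"] by (auto simp: K_def card_image subset_iff)
  have "card (S - K) \<le> card (K - S)"
    using S K by (simp add: card_Diff_subset_Int Int_commute diff_le_mono)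
  then obtain \<phi> where \<phi>: "\<phi> ` (S - K) \<subseteq> K - S" "inj_on \<phi> (S - K)"
    using card_le_inj[of "S - K" "K - S"] S K by auto
  let ?\<psi> = "\<lambda>j. if j \<in> S then \<phi> j else j"
  have "lp_le p (- K) lam c"
  proof (rule lp_le_dominated[OF le, of ?\<psi>])
    show "inj_on ?\<psi> (- K)" using \<phi> unfolding inj_on_def by (auto split: if_splits)
    show "?\<psi> ` (- K) \<subseteq> - S" using \<phi>(1) by auto
    fix j assume j: "j \<in> - K"
    show "norm (lam j) \<le> norm (lam (?\<psi> j))"
    proof (cases "j \<in> S")
      case True
      then have "\<phi> j \<in> K" using \<phi>(1) j by auto
      then obtain l where l: "l \<in> {1..m}" "\<phi> j = k l" by (auto simp: K_def)
      obtain i where i: "m < i" "j = k i" using not_in_head[of j m] j by (auto simp: K_def)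
      have "lam j \<le> lam (\<phi> j)" using l i weights_antimono[of l i] by auto
      then show ?thesis using True weights_pos[of j] by auto
    qed simp
  qed
  then show ?thesis by (simp add: K_def)
qed

section \<open>The data-based error bound and the cost of the algorithm\<close>

lemma ball_iff: "0 \<le> R \<Longrightarrow> f \<in> F_ball \<rho> lam R \<longleftrightarrow> lp_le \<rho> UNIV (weighted lam f) R"
  by (simp add: F_ball_def F_space_def F_norm_def lp_le_iff rho_ge_1)

lemma cone_iff: "f \<in> cone \<longleftrightarrow> lp_le \<rho> UNIV (weighted lam f) (A * head f n1)"
  using A head_nonneg[of f n1] by (simp add: data_cone_def F_space_def F_norm_def lp_le_iff rho_ge_1)

lemma norm_eq_weighted: "norm (f j) = norm (weighted lam f j) * norm (lam j)"
  using weights_pos[of j] by (simp add: weighted_def norm_divide)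

lemma head_le: "0 \<le> R \<Longrightarrow> lp_le \<rho> UNIV (weighted lam f) R \<Longrightarrow> head f n \<le> R"
  unfolding head_le_iff by (erule lp_le_subset) simp

lemma weighted_le_head: "j \<in> k ` {1..n} \<Longrightarrow> norm (weighted lam f j) \<le> head f n"
  using head_le_iff[OF head_nonneg, of f n f n]
    lp_le_subset[of \<rho> "k ` {1..n}" "weighted lam f" "head f n" "{j}"]
  by (simp add: lp_le_singleton rho_ge_1 head_nonneg)

text \<open>
  The first factor of \<open>ERR\<close>: what the cone condition leaves for the norm of the coefficients
  that have not been sampled.
\<close>

definition residual :: "('k \<Rightarrow> 'a::{real_normed_field,banach}) \<Rightarrow> nat \<Rightarrow> real" where
  "residual f n =
     (if \<rho> = \<infinity> then A * head f n1
      else (A powr enn2real \<rho> * head f n1 powr enn2real \<rho> - head f n powr enn2real \<rho>)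
        powr (1 / enn2real \<rho>))"

text \<open>
  To be used by unfolding: rewriting \<open>\<rho>\<close> itself to infinity would alter the parameters of the locale
  inside the defined constant \<open>residual\<close>.
\<close>

lemma residual_infinite: "\<rho> = \<infinity> \<Longrightarrow> residual f n = A * head f n1"
  unfolding residual_def by (rule if_P)

lemma ERR_eq: "ERR \<rho> \<rho>' lam k n1 A f n = residual f n * tail n"
  by (simp add: ERR_def residual_def)

lemma residual_nonneg: "0 \<le> residual f n"
proof (cases "\<rho> = \<infinity>")
  case True
  show ?thesis unfolding residual_infinite[OF True] using A head_nonneg[of f n1] by simp
qed (simp add: residual_def)

text \<open>
  The \<open>\<rho>\<close>-th powers of the norms of the sampled and the unsampled part add up to that of the whole,
  which the cone condition bounds by \<open>A * head f n1\<close>.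
\<close>

lemma residual_correct:
  assumes f: "f \<in> cone"
  shows "lp_le \<rho> (- k ` {1..n}) (weighted lam f) (residual f n)"
proof (cases "\<rho> = \<infinity>")
  case True
  show ?thesis
    using f unfolding cone_iff residual_infinite[OF True] by (rule lp_le_subset) simp
next
  case False
  define r where "r = enn2real \<rho>"
  have r: "1 \<le> r" unfolding r_def by (rule enn2real_ge_1[OF rho_ge_1 False])
  let ?g = "\<lambda>j. norm (weighted lam f j) powr r"
  have *: "sum ?g F + sum ?g (k ` {1..n}) \<le> A powr r * head f n1 powr r"
    if F: "finite F" "F \<subseteq> - k ` {1..n}" for F
  proof -
    have "sum ?g F + sum ?g (k ` {1..n}) = sum ?g (F \<union> k ` {1..n})"
      using F by (intro sum.union_disjoint[symmetric]) auto
    also have "\<dots> \<le> (A * head f n1) powr r"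
      using f False F by (auto simp: cone_iff lp_le_def r_def)
    finally show ?thesis using A head_nonneg[of f n1] by (simp add: powr_mult)
  qed
  define D where "D = A powr r * head f n1 powr r - head f n powr r"
  have head: "head f n powr r = sum ?g (k ` {1..n})" using head_powr[OF False] by (simp add: r_def)
  have D: "sum ?g F \<le> D" if "finite F" "F \<subseteq> - k ` {1..n}" for F
    using *[OF that] by (simp add: D_def head)
  have "0 \<le> D" using D[of "{}"] by simp
  then have "residual f n powr r = D" using r False by (simp add: residual_def D_def r_def powr_powr)
  then show ?thesis using D False by (simp add: lp_le_def r_def)
qed

text \<open>
  For finite \<open>\<rho>\<close> and \<open>n \<ge> n1\<close> the head norm subtracted in the bracket is at least the one multiplied by \<open>A\<close>, so the
  bracket is at most \<open>(A powr \<rho> - 1) * head f n1 powr \<rho>\<close>. Equality holds for inputs concentrated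
  in the first coefficient (see \<open>residual_spike\<close>); hence the bound is the exact worst case.
\<close>

lemma residual_le:
  assumes f: "f \<in> cone" "f \<in> F_ball \<rho> lam R" and R: "0 \<le> R" and n: "n1 \<le> n"
  shows "residual f n \<le> inflation \<rho> A * R"
proof -
  have h1: "head f n1 \<le> R" using f(2) R by (simp add: ball_iff head_le)
  show ?thesis
  proof (cases "\<rho> = \<infinity>")
    case True
    have "inflation \<rho> A = A" using True by (simp add: inflation_def)
    then show ?thesis unfolding residual_infinite[OF True] using h1 A by simp
  next
    case False
    define r where "r = enn2real \<rho>"
    have r: "1 \<le> r" unfolding r_def by (rule enn2real_ge_1[OF rho_ge_1 False])
    have A1: "1 < A powr r" using A r by (simp add: gr_one_powr)
    define D where "D = A powr r * head f n1 powr r - head f n powr r"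
    have "head f n \<le> A * head f n1"
      using f(1) head_nonneg[of f n1] A by (intro head_le) (auto simp: cone_iff)
    then have "head f n powr r \<le> (A * head f n1) powr r"
      using r by (intro powr_mono2 head_nonneg) auto
    then have D0: "0 \<le> D" using A head_nonneg[of f n1] by (simp add: D_def powr_mult)
    have "head f n1 \<le> head f n"
      unfolding head_le_iff[OF head_nonneg]
      using head_le_iff[OF head_nonneg, of f n f n] n by (auto elim!: lp_le_subset)
    then have "head f n1 powr r \<le> head f n powr r"
      using r by (intro powr_mono2 head_nonneg) auto
    then have "D \<le> (A powr r - 1) * head f n1 powr r" by (simp add: D_def left_diff_distrib)
    also have "\<dots> \<le> (A powr r - 1) * R powr r"
      using h1 A1 r by (intro mult_left_mono powr_mono2 head_nonneg) auto
    finally have "D powr (1/r) \<le> ((A powr r - 1) * R powr r) powr (1/r)"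
      using D0 r by (intro powr_mono2) auto
    also have "\<dots> = (A powr r - 1) powr (1/r) * R"
      using A1 R r by (simp add: powr_mult powr_powr)
    finally show ?thesis using False by (simp add: residual_def D_def r_def inflation_def)
  qed
qed

lemma inflation_pos: "0 < inflation \<rho> A"
proof (cases "\<rho> = \<infinity>")
  case False
  then have "1 < A powr enn2real \<rho>"
    using A enn2real_ge_1[OF rho_ge_1] by (intro gr_one_powr) force+
  then show ?thesis using False by (simp add: inflation_def)
qed (use A in \<open>simp add: inflation_def\<close>)

text \<open>
  On the unsampled wavenumbers the error is the product of the weighted coefficients and the
  weights, and Hoelder's inequality separates the two.
\<close>

lemma ERR_bounds_error:
  assumes f: "f \<in> cone"
  shows "lp_le \<tau> UNIV (\<lambda>j. SOL f j - APP k f n j) (ERR \<rho> \<rho>' lam k n1 A f n)"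
proof -
  have "lp_le \<tau> (- k ` {1..n}) (\<lambda>j. SOL f j - APP k f n j) (residual f n * tail n)"
  proof (rule hoelder[OF residual_correct[OF f]])
    show "lp_le \<rho>' (- k ` {1..n}) lam (tail n)" using tail_le_iff[OF tail_nonneg] by blast
    fix j assume "j \<in> - k ` {1..n}"
    then show "norm (SOL f j - APP k f n j) \<le> norm (weighted lam f j) * norm (lam j)"
      using norm_eq_weighted[of f j] by (auto simp: SOL_def APP_def)
  qed (rule residual_nonneg tail_nonneg)+
  then show ?thesis unfolding ERR_eq
    by (rule lp_le_extend_zero) (auto simp: SOL_def APP_def residual_nonneg tail_nonneg)
qed

lemma cone_alg_correct:
  assumes f: "f \<in> cone" and \<epsilon>: "0 < \<epsilon>" and ret: "returns (cone_alg \<rho> \<rho>' lam k n1 A) \<epsilon> f g"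
  shows "g \<in> G_space \<tau>" and "G_norm \<tau> (\<lambda>j. SOL f j - g j) \<le> \<epsilon>"
proof -
  obtain n where n: "ERR \<rho> \<rho>' lam k n1 A f n \<le> \<epsilon>" and g: "g = APP k f n"
    using ret unfolding returns_cone_alg_iff by blast
  show "g \<in> G_space \<tau>"
    unfolding G_space_def mem_Collect_eq g
    by (rule lp_finite_finite_support[of "k ` {1..n}"]) (auto simp: APP_def tau_ge_1)
  have "0 \<le> ERR \<rho> \<rho>' lam k n1 A f n" by (simp add: ERR_eq residual_nonneg tail_nonneg)
  then have "lp_le \<tau> UNIV (\<lambda>j. SOL f j - g j) \<epsilon>"
    using lp_le_mono[OF ERR_bounds_error[OF f] _ n] g by simp
  then show "G_norm \<tau> (\<lambda>j. SOL f j - g j) \<le> \<epsilon>"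
    using \<epsilon> by (simp add: G_norm_def lp_le_iff tau_ge_1)
qed

lemma cone_alg_in_algorithms:
  assumes "\<rho>' \<noteq> \<infinity> \<or> (\<lambda>i. lam (k i)) \<longlonglongrightarrow> 0"
  shows "cone_alg \<rho> \<rho>' lam k n1 A \<in> algorithms \<tau> (cone :: ('k \<Rightarrow> 'a::{real_normed_field,banach}) set)"
proof -
  have "\<exists>g. returns (cone_alg \<rho> \<rho>' lam k n1 A) \<epsilon> f g" if \<epsilon>: "0 < \<epsilon>" and f: "f \<in> cone"
    for \<epsilon> and f :: "'k \<Rightarrow> 'a"
  proof -
    define R where "R = A * head f n1 + 1"
    have R: "0 < R" using A head_nonneg[of f n1] by (simp add: R_def add_nonneg_pos)
    have "lp_le \<rho> UNIV (weighted lam f) R"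
      using f A head_nonneg[of f n1] unfolding cone_iff by (elim lp_le_mono) (auto simp: R_def)
    then have ball: "f \<in> F_ball \<rho> lam R" using R by (simp add: ball_iff)
    define t where "t = \<epsilon> / (inflation \<rho> A * R)"
    have t: "0 < t" using \<epsilon> R inflation_pos by (simp add: t_def)
    obtain n where n: "n1 \<le> n" "tail n \<le> t" using tail_eventually_small[OF assms t] by blast
    have "residual f n * tail n \<le> inflation \<rho> A * R * t"
      using residual_le[OF f ball _ n(1)] R n(2) tail_nonneg residual_nonneg inflation_pos 
      by (intro mult_mono) (auto simp: less_imp_le)
    also have "\<dots> = \<epsilon>" using inflation_pos R by (simp add: t_def)
    finally have "n1 \<le> n \<and> ERR \<rho> \<rho>' lam k n1 A f n \<le> \<epsilon>" using n by (simp add: ERR_eq)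
    then obtain m where "n1 \<le> m \<and> ERR \<rho> \<rho>' lam k n1 A f m \<le> \<epsilon>"
      "\<forall>i<m. \<not> (n1 \<le> i \<and> ERR \<rho> \<rho>' lam k n1 A f i \<le> \<epsilon>)"
      using exists_least_iff[of "\<lambda>n. n1 \<le> n \<and> ERR \<rho> \<rho>' lam k n1 A f n \<le> \<epsilon>"] by blast
    then show ?thesis unfolding returns_cone_alg_iff by blast
  qed
  then show ?thesis unfolding algorithms_def using cone_alg_correct by blast
qed

lemma weighted_spike: "weighted lam (spike lam j c) = (\<lambda>i. if i = j then of_real c else 0)"
  using weights_pos[of j] by (auto simp: weighted_def spike_def)

lemma lp_le_spike:
  assumes "0 \<le> c" "0 \<le> d" "j \<in> S"
  shows "lp_le \<rho> S (weighted lam (spike lam j c :: 'k \<Rightarrow> 'a::{real_normed_field,banach})) d \<longleftrightarrow> c \<le> d"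
proof -
  let ?w = "weighted lam (spike lam j c :: 'k \<Rightarrow> 'a)"
  have "lp_le \<rho> {j} ?w d \<longleftrightarrow> c \<le> d"
    using assms by (simp add: lp_le_singleton rho_ge_1 weighted_spike)
  moreover have "lp_le \<rho> S ?w d \<Longrightarrow> lp_le \<rho> {j} ?w d" using assms(3) by (elim lp_le_subset) auto
  moreover have "lp_le \<rho> {j} ?w d \<Longrightarrow> lp_le \<rho> S ?w d"
    using assms(2) by (elim lp_le_extend_zero) (auto simp: weighted_spike)
  ultimately show ?thesis by blast
qed

lemma head_spike:
  assumes c: "0 \<le> c" and n: "1 \<le> n"
  shows "head (spike lam (k 1) c :: 'k \<Rightarrow> 'a::{real_normed_field,banach}) n = c"
proof -
  let ?f = "spike lam (k 1) c :: 'k \<Rightarrow> 'a"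
  have "head ?f n \<le> d \<longleftrightarrow> c \<le> d" if "0 \<le> d" for d
    using that c n by (simp add: head_le_iff lp_le_spike)
  from this[OF c] this[OF head_nonneg, of ?f n] show ?thesis by simp
qed

lemma spike_in_cone:
  assumes c: "0 \<le> c"
  shows "spike lam (k 1) c \<in> cone"
proof -
  have "c \<le> A * c" using c A mult_right_mono[of 1 A c] by simp
  then show ?thesis using c A n1 unfolding cone_iff head_spike[OF c n1] by (simp add: lp_le_spike)
qed

lemma spike_in_ball: "0 \<le> c \<Longrightarrow> c \<le> R \<Longrightarrow> spike lam j c \<in> F_ball \<rho> lam R"
  by (simp add: ball_iff lp_le_spike)

lemma residual_spike:
  assumes c: "0 \<le> c" and n: "n1 \<le> n"
  shows "residual (spike lam (k 1) c :: 'k \<Rightarrow> 'a::{real_normed_field,banach}) n = inflation \<rho> A * c"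
proof (cases "\<rho> = \<infinity>")
  case True
  have "inflation \<rho> A = A" using True by (simp add: inflation_def)
  then show ?thesis unfolding residual_infinite[OF True] head_spike[OF c n1] by simp
next
  case False
  define r where "r = enn2real \<rho>"
  have r: "1 \<le> r" unfolding r_def by (rule enn2real_ge_1[OF rho_ge_1 False])
  have "1 < A powr r" using A r by (simp add: gr_one_powr)
  then have "((A powr r - 1) * c powr r) powr (1/r) = (A powr r - 1) powr (1/r) * c"
    using c r by (simp add: powr_mult powr_powr)
  moreover have "head (spike lam (k 1) c :: 'k \<Rightarrow> 'a) n = c"
    using n n1 by (intro head_spike c) simp
  ultimately show ?thesis
    using False head_spike[OF c n1, where 'a = 'a] by (simp add: residual_def inflation_def r_def left_diff_distrib)
qed

text \<open>
  The worst input of norm \<open>R\<close> is the spike at the first wavenumber, for which the stopping criterion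
  becomes the condition on the tail norm alone.
\<close>

lemma COST_cone_alg:
  assumes \<epsilon>: "0 < \<epsilon>" and R: "0 < R"
  shows "COST \<rho> lam (cone_alg \<rho> \<rho>' lam k n1 A) (cone :: ('k \<Rightarrow> 'a::{real_normed_field,banach}) set) \<epsilon> R =
    first_n (\<lambda>n. n1 \<le> n \<and> tail n \<le> \<epsilon> / (inflation \<rho> A * R))"
proof (rule antisym)
  have IR: "0 < inflation \<rho> A * R" using inflation_pos R by simp
  show "COST \<rho> lam (cone_alg \<rho> \<rho>' lam k n1 A) (cone :: ('k \<Rightarrow> 'a) set) \<epsilon> R
      \<le> first_n (\<lambda>n. n1 \<le> n \<and> tail n \<le> \<epsilon> / (inflation \<rho> A * R))"
    unfolding COST_def
  proof (rule SUP_least)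
    fix f :: "'k \<Rightarrow> 'a" assume f: "f \<in> cone \<inter> F_ball \<rho> lam R"
    show "cost (cone_alg \<rho> \<rho>' lam k n1 A) f \<epsilon>
        \<le> first_n (\<lambda>n. n1 \<le> n \<and> tail n \<le> \<epsilon> / (inflation \<rho> A * R))"
      unfolding cost_cone_alg[OF inj_k]
    proof (rule first_n_mono, elim conjE, intro conjI)
      fix n assume n: "n1 \<le> n" "tail n \<le> \<epsilon> / (inflation \<rho> A * R)"
      have "residual f n * tail n \<le> (inflation \<rho> A * R) * (\<epsilon> / (inflation \<rho> A * R))"
        using residual_le[of f R n] f R n tail_nonneg IR by (intro mult_mono) auto
      also have "\<dots> = \<epsilon>" using IR by (metis less_irrefl nonzero_mult_div_cancel_left times_divide_eq_right)
      finally show "ERR \<rho> \<rho>' lam k n1 A f n \<le> \<epsilon>" by (simp only: ERR_eq)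
    qed
  qed
  let ?f = "spike lam (k 1) R :: 'k \<Rightarrow> 'a"
  have "first_n (\<lambda>n. n1 \<le> n \<and> tail n \<le> \<epsilon> / (inflation \<rho> A * R))
      \<le> cost (cone_alg \<rho> \<rho>' lam k n1 A) ?f \<epsilon>"
    unfolding cost_cone_alg[OF inj_k]
  proof (rule first_n_mono, elim conjE, intro conjI)
    fix n assume n: "n1 \<le> n" "ERR \<rho> \<rho>' lam k n1 A ?f n \<le> \<epsilon>"
    then have "inflation \<rho> A * R * tail n \<le> \<epsilon>" using R residual_spike[of R n, where 'a='a] by (simp add: ERR_eq)
    then show "tail n \<le> \<epsilon> / (inflation \<rho> A * R)" using IR by (simp add: pos_le_divide_eq mult.commute)
  qed
  also have "\<dots> \<le> COST \<rho> lam (cone_alg \<rho> \<rho>' lam k n1 A) (cone :: ('k \<Rightarrow> 'a) set) \<epsilon> R"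
    unfolding COST_def using R by (intro SUP_upper IntI spike_in_cone spike_in_ball) simp_all
  finally show "first_n (\<lambda>n. n1 \<le> n \<and> tail n \<le> \<epsilon> / (inflation \<rho> A * R))
      \<le> COST \<rho> lam (cone_alg \<rho> \<rho>' lam k n1 A) (cone :: ('k \<Rightarrow> 'a) set) \<epsilon> R" .
qed

section \<open>Fooling inputs and lower bounds\<close>

text \<open>
  The norm of the center is \<open>(1 - a) * R\<close> with \<open>a = (1 - 1 / A) / 2\<close>. This \<open>a\<close> is the largest radius for
  which every perturbation of norm \<open>a * R\<close> is harmless: it keeps the norm at most \<open>R\<close> and the head
  norm at least \<open>(1 - a) * R - a * R = R / A\<close>.
\<close>

definition center :: "real \<Rightarrow> 'k \<Rightarrow> 'a::{real_normed_field,banach}" where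
  "center R = spike lam (k 1) ((1 + 1 / A) / 2 * R)"

lemma center_in_cone: "0 \<le> R \<Longrightarrow> center R \<in> cone"
  unfolding center_def using A by (intro spike_in_cone) simp

lemma center_in_ball: "0 \<le> R \<Longrightarrow> center R \<in> F_ball \<rho> lam R"
  unfolding center_def using A by (intro spike_in_ball mult_left_le_one_le mult_nonneg_nonneg) auto

text \<open>
  The sum of the center and the perturbation is the convex combination, with coefficients \<open>1 - a\<close> and
  \<open>a\<close>, of two inputs of norm at most \<open>R\<close>, while the first coefficient alone keeps the head norm at
  \<open>R / A\<close> or more. The head norm can drop that low, since the perturbation may cancel part of the
  first coefficient.
\<close>

lemma perturbation_in_cone:
  assumes R: "0 < R" and y: "lp_le \<rho> UNIV y ((1 - 1 / A) / 2 * R)" and s: "\<bar>s\<bar> = 1"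
  shows "(\<lambda>j. center R j + of_real (s * (lam j * y j)) :: 'a::{real_normed_field,banach}) \<in> cone"
proof -
  define a where "a = (1 - 1 / A) / 2"
  have a: "0 < a" "a < 1" and a': "(1 + 1 / A) / 2 = 1 - a" using A by (auto simp: a_def field_simps)
  let ?f = "\<lambda>j. center R j + of_real (s * (lam j * y j)) :: 'a"
  let ?u = "\<lambda>j. if j = k 1 then R else 0"
  have w: "weighted lam ?f j = of_real ((1 - a) * ?u j + s * y j)" for j
    using weights_pos[of j] by (simp add: weighted_def center_def spike_def a' field_simps)
  have wn: "norm (weighted lam ?f j) = \<bar>(1 - a) * ?u j + s * y j\<bar>" for j
    unfolding w norm_of_real ..
  have sy: "\<bar>s * y j\<bar> = \<bar>y j\<bar>" for j using s by (simp add: abs_mult)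
  have "lp_le \<rho> {k 1} ?u R" using R by (simp add: lp_le_singleton rho_ge_1)
  then have u: "lp_le \<rho> UNIV ?u R" using R by (elim lp_le_extend_zero) auto
  have y': "lp_le \<rho> UNIV (\<lambda>j. y j / a) R"
  proof -
    have "lp_le \<rho> UNIV (\<lambda>j. y j / a) (1 / a * (a * R))"
      using y a R unfolding a_def[symmetric] by (elim lp_le_scale) auto
    then show ?thesis using a by simp
  qed
  have R1: "lp_le \<rho> UNIV (weighted lam ?f) R"
  proof (rule lp_le_convex_combination[OF rho_ge_1 _ _ _ u y', of "1 - a" a])
    fix j
    have "\<bar>(1 - a) * ?u j + s * y j\<bar> \<le> \<bar>(1 - a) * ?u j\<bar> + \<bar>y j\<bar>"
      using abs_triangle_ineq[of "(1 - a) * ?u j" "s * y j"] unfolding sy .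
    then show "norm (weighted lam ?f j) \<le> (1 - a) * norm (?u j) + a * norm (y j / a)"
      unfolding wn using a by (simp add: abs_mult)
  qed (use a in auto)
  have "lp_le \<rho> {k 1} y (a * R)" using y unfolding a_def[symmetric] by (rule lp_le_subset) simp
  then have "\<bar>y (k 1)\<bar> \<le> a * R" using a R by (simp add: lp_le_singleton rho_ge_1)
  then have "(1 - a) * R - a * R \<le> norm (weighted lam ?f (k 1))"
    unfolding wn using sy[of "k 1"] by simp
  also have "\<dots> \<le> head ?f n1" using n1 by (intro weighted_le_head) auto
  finally have "R / A \<le> head ?f n1" using A by (simp add: a_def field_simps)
  then have "R \<le> A * head ?f n1" using A by (simp add: field_simps)
  then show ?thesis unfolding cone_iff using lp_le_mono[OF R1] R by simp
qed

lemma cone_in_G: "f \<in> cone \<Longrightarrow> lp_finite \<tau> UNIV f"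
proof -
  assume f: "f \<in> cone"
  have nn: "0 \<le> lp_norm \<rho>' UNIV lam" "0 \<le> A * head f n1"
    using A head_nonneg[of f n1] by (auto intro: lp_norm_nonneg weights_finite)
  have "lp_le \<rho>' UNIV lam (lp_norm \<rho>' UNIV lam)"
    using weights_finite nn by (simp add: lp_le_iff[OF rho'_ge_1])
  then have "lp_le \<tau> UNIV f (A * head f n1 * lp_norm \<rho>' UNIV lam)"
    using f nn norm_eq_weighted[of f] unfolding cone_iff
    by (intro hoelder[where x = "weighted lam f" and y = lam]) simp_all
  then show ?thesis using nn by (simp add: lp_le_iff tau_ge_1)
qed

text \<open>
  A perturbation supported outside the sampled set is invisible, so the algorithm returns the
  same \<open>v\<close> after adding and after subtracting it. The perturbation is half the difference of the
  two errors and hence is at most \<open>\<epsilon>\<close> in norm. By duality the weights outside the sampled set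
  then have a small norm, and the tail norm is no larger.
\<close>

lemma sampling_lower_bound:
  assumes alg: "alg \<in> algorithms \<tau> (cone :: ('k \<Rightarrow> 'a::{real_normed_field,banach}) set)"
    and \<epsilon>: "0 < \<epsilon>" and R: "0 < R"
    and m: "card (sampled alg \<epsilon> (center R)) \<le> m"
  shows "tail m \<le> 2 * \<epsilon> / ((1 - 1 / A) * R)"
proof -
  let ?S = "sampled alg \<epsilon> (center R)"
  have "\<exists>v. returns alg \<epsilon> (center R) v"
    using alg \<epsilon> center_in_cone[OF less_imp_le[OF R]] unfolding algorithms_def by blast
  then have finS: "finite ?S" using finite_sampled by blast
  define c where "c = (1 - 1 / A) / 2 * R"
  have c: "0 < c" using A R by (simp add: c_def)
  have "lp_le \<rho>' (- ?S) lam (\<epsilon> / c)"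
  proof (rule hoelder_converse)
    fix y :: "'k \<Rightarrow> real" and F
    assume F: "finite F" "F \<subseteq> - ?S" and y0: "\<And>i. i \<notin> F \<Longrightarrow> y i = 0" and y: "lp_le \<rho> UNIV y c"
    let ?f = "\<lambda>s j. center R j + of_real (s * (lam j * y j)) :: 'a"
    have "\<exists>v\<in>G_space \<tau>. returns alg \<epsilon> (center R) v \<and> lp_le \<tau> UNIV (\<lambda>j. ?f s j - v j) \<epsilon>"
      if s: "\<bar>s\<bar> = 1" for s
    proof -
      have C: "?f s \<in> cone" using perturbation_in_cone[OF R _ s] y unfolding c_def by blast
      then obtain v where v: "v \<in> G_space \<tau>" "returns alg \<epsilon> (?f s) v"
        "G_norm \<tau> (\<lambda>j. SOL (?f s) j - v j) \<le> \<epsilon>"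
        using alg \<epsilon> unfolding algorithms_def by blast
      have "lp_finite \<tau> UNIV (\<lambda>j. ?f s j - v j)"
        using cone_in_G[OF C] v(1) by (intro lp_finite_diff tau_ge_1) (auto simp: G_space_def)
      then have "lp_le \<tau> UNIV (\<lambda>j. ?f s j - v j) \<epsilon>"
        using v(3) \<epsilon> by (simp add: lp_le_iff tau_ge_1 G_norm_def SOL_def)
      moreover have "returns alg \<epsilon> (center R) v"
        using v(2) returns_cong[of alg \<epsilon> "center R" "?f s" v] y0 F(2) by force
      ultimately show ?thesis using v(1) by blast
    qed
    from this[of 1] this[of "-1"] obtain v where
      v: "lp_le \<tau> UNIV (\<lambda>j. ?f 1 j - v j) \<epsilon>" "lp_le \<tau> UNIV (\<lambda>j. ?f (-1) j - v j) \<epsilon>"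
      using returns_unique[of alg \<epsilon> "center R"] by auto
    show "lp_le \<tau> UNIV (\<lambda>j. lam j * y j) \<epsilon>"
    proof (rule lp_le_convex_combination[OF tau_ge_1 _ _ _ v, of "1/2" "1/2"])
      fix j
      have "2 * \<bar>lam j * y j\<bar> = norm (2 * of_real (lam j * y j) :: 'a)"
        by (simp only: norm_mult norm_of_real norm_numeral)
      also have "2 * of_real (lam j * y j) = (?f 1 j - v j) - (?f (-1) j - v j)" by simp
      also have "norm \<dots> \<le> norm (?f 1 j - v j) + norm (?f (-1) j - v j)" by (rule norm_triangle_ineq4)
      finally show "norm (lam j * y j) \<le> 1/2 * norm (?f 1 j - v j) + 1/2 * norm (?f (-1) j - v j)"
        by simp
    qed auto
  qed (use weights_pos c \<epsilon> in auto)
  then have "lp_le \<rho>' (- k ` {1..m}) lam (\<epsilon> / c)" by (rule lp_le_weights_outside[OF finS m])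
  then have "tail m \<le> \<epsilon> / c" using \<epsilon> c by (subst tail_le_iff) auto
  also have "\<epsilon> / c = 2 * \<epsilon> / ((1 - 1 / A) * R)" by (simp add: c_def)
  finally show ?thesis .
qed

text \<open>
  A threshold below \<open>tail n1\<close> rules out algorithms that sample fewer than \<open>n1\<close> coefficients, so that
  the minimum on the left may be restricted to \<open>n \<ge> n1\<close>.
\<close>

lemma COMP_lower_bound:
  assumes \<epsilon>: "0 < \<epsilon>" and R: "0 < R" and small: "2 * \<epsilon> / ((1 - 1 / A) * R) < tail n1"
  shows "first_n (\<lambda>n. n1 \<le> n \<and> tail n \<le> 2 * \<epsilon> / ((1 - 1 / A) * R))
    \<le> COMP \<tau> \<rho> lam (cone :: ('k \<Rightarrow> 'a::{real_normed_field,banach}) set) \<epsilon> R"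
  unfolding COMP_def
proof (rule INF_greatest)
  fix alg assume alg: "alg \<in> algorithms \<tau> (cone :: ('k \<Rightarrow> 'a) set)"
  let ?S = "sampled alg \<epsilon> (center R)"
  have "first_n (\<lambda>n. n1 \<le> n \<and> tail n \<le> 2 * \<epsilon> / ((1 - 1 / A) * R)) \<le> cost alg (center R) \<epsilon>"
  proof (cases "finite ?S")
    case True
    have "tail (card ?S) \<le> 2 * \<epsilon> / ((1 - 1 / A) * R)"
      by (rule sampling_lower_bound[OF alg \<epsilon> R order_refl])
    moreover from this have "n1 \<le> card ?S"
      using small tail_antimono[of "card ?S" n1] by linarith
    ultimately have "first_n (\<lambda>n. n1 \<le> n \<and> tail n \<le> 2 * \<epsilon> / ((1 - 1 / A) * R)) \<le> enat (card ?S)"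
      by (intro first_n_le) simp
    then show ?thesis using True by (simp add: cost_def)
  qed (simp add: cost_def)
  also have "\<dots> \<le> COST \<rho> lam alg cone \<epsilon> R"
    unfolding COST_def using R by (intro SUP_upper IntI center_in_cone center_in_ball) simp_all
  finally show "first_n (\<lambda>n. n1 \<le> n \<and> tail n \<le> 2 * \<epsilon> / ((1 - 1 / A) * R)) \<le> COST \<rho> lam alg cone \<epsilon> R" .
qed

lemma COMP_lower_bound_eventually:
  "\<exists>\<epsilon>max>0. \<exists>Rmin>0. \<forall>\<epsilon> R. 0 < \<epsilon> \<longrightarrow> \<epsilon> \<le> \<epsilon>max \<longrightarrow> Rmin \<le> R \<longrightarrow>
     first_n (\<lambda>n. n1 \<le> n \<and> tail n \<le> 2 * \<epsilon> / ((1 - 1 / A) * R))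
       \<le> COMP \<tau> \<rho> lam (cone :: ('k \<Rightarrow> 'a::{real_normed_field,banach}) set) \<epsilon> R"
proof -
  define d where "d = 1 - 1 / A"
  have d: "0 < d" using A by (simp add: d_def)
  \<comment> \<open>With \<open>Rmin = 1\<close> the threshold is at most \<open>tail n1 / 2\<close>.\<close>
  define \<epsilon>max where "\<epsilon>max = d * tail n1 / 4"
  have "0 < \<epsilon>max" using d tail_pos by (simp add: \<epsilon>max_def)
  moreover have "2 * \<epsilon> / (d * R) < tail n1" if "0 < \<epsilon>" "\<epsilon> \<le> \<epsilon>max" "1 \<le> R" for \<epsilon> R
  proof -
    have "2 * \<epsilon> / (d * R) \<le> 2 * \<epsilon>max / (d * 1)"
      using that d by (intro frac_le mult_left_mono) auto
    also have "\<dots> < tail n1" using d tail_pos[of n1] by (simp add: \<epsilon>max_def)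
    finally show ?thesis .
  qed
  ultimately have "\<forall>\<epsilon> R. 0 < \<epsilon> \<longrightarrow> \<epsilon> \<le> \<epsilon>max \<longrightarrow> 1 \<le> R \<longrightarrow>
      first_n (\<lambda>n. n1 \<le> n \<and> tail n \<le> 2 * \<epsilon> / (d * R))
        \<le> COMP \<tau> \<rho> lam (cone :: ('k \<Rightarrow> 'a) set) \<epsilon> R"
    by (intro allI impI COMP_lower_bound[folded d_def]) auto
  then show ?thesis unfolding d_def[symmetric] using \<open>0 < \<epsilon>max\<close> zero_less_one by blast
qed

lemma cone_alg_essentially_optimal:
  "essentially_optimal \<tau> \<rho> lam (cone :: ('k \<Rightarrow> 'a::{real_normed_field,banach}) set)
     (cone_alg \<rho> \<rho>' lam k n1 A)"
proof -
  obtain \<epsilon>max Rmin where pos: "0 < \<epsilon>max" "0 < Rmin" and lower: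
    "\<And>\<epsilon> R. 0 < \<epsilon> \<Longrightarrow> \<epsilon> \<le> \<epsilon>max \<Longrightarrow> Rmin \<le> R \<Longrightarrow>
       first_n (\<lambda>n. n1 \<le> n \<and> tail n \<le> 2 * \<epsilon> / ((1 - 1 / A) * R))
         \<le> COMP \<tau> \<rho> lam (cone :: ('k \<Rightarrow> 'a) set) \<epsilon> R"
    using COMP_lower_bound_eventually[where 'a = 'a] by blast
  \<comment> \<open>This \<open>\<omega>\<close> makes the threshold of the lower bound at \<open>\<omega> * \<epsilon>\<close> equal to that of the exact cost at \<open>\<epsilon>\<close>.\<close>
  define \<omega> where "\<omega> = (1 - 1 / A) / (2 * inflation \<rho> A)"
  have \<omega>: "0 < \<omega>" using A inflation_pos by (simp add: \<omega>_def)
  have "COST \<rho> lam (cone_alg \<rho> \<rho>' lam k n1 A) (cone :: ('k \<Rightarrow> 'a) set) \<epsilon> R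
      \<le> COMP \<tau> \<rho> lam (cone :: ('k \<Rightarrow> 'a) set) (\<omega> * \<epsilon>) R"
    if "0 < \<epsilon>" "\<epsilon> \<le> \<epsilon>max / \<omega>" "Rmin \<le> R" for \<epsilon> R
  proof -
    have "2 * (\<omega> * \<epsilon>) / ((1 - 1 / A) * R) = \<epsilon> / (inflation \<rho> A * R)"
      using A by (simp add: \<omega>_def)
    then show ?thesis
      using lower[of "\<omega> * \<epsilon>" R] that \<omega> pos COST_cone_alg[of \<epsilon> R, where 'a = 'a]
      by (simp add: pos_le_divide_eq mult.commute)
  qed
  then show ?thesis
    unfolding essentially_optimal_def using \<omega> pos
    by (intro exI[of _ \<omega>] conjI exI[of _ "\<epsilon>max / \<omega>"] exI[of _ Rmin]) auto
qed

text \<open>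
  A non-adaptive algorithm would use one and the same finite sample for the tolerance \<open>1\<close> on the
  whole cone, in particular for the centers of all sizes. As the cone is unbounded, the lower bound
  for a center of large size contradicts that the tail norms are positive.
\<close>

lemma algorithms_adaptive:
  assumes alg: "alg \<in> algorithms \<tau> (cone :: ('k \<Rightarrow> 'a::{real_normed_field,banach}) set)"
  shows "\<not> non_adaptive (cone :: ('k \<Rightarrow> 'a) set) alg"
proof
  assume na: "non_adaptive (cone :: ('k \<Rightarrow> 'a) set) alg"
  define S where "S = sampled alg 1 (center 1)"
  have S: "sampled alg 1 (center R) = S" if "0 < R" for R
    using na center_in_cone[of R] center_in_cone[of 1] that unfolding non_adaptive_def S_def
    by (metis zero_less_one less_imp_le)
  define d where "d = 1 - 1 / A"
  \<comment> \<open>The size is chosen such that the lower bound would give \<open>tail (card S) \<le> tail (card S) / 2\<close>.\<close>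
  define R where "R = 4 / (d * tail (card S))"
  have pos: "0 < d" "0 < tail (card S)" using A tail_pos by (auto simp: d_def)
  then have R: "0 < R" by (simp add: R_def)
  have eq: "2 / ((1 - 1 / A) * R) = tail (card S) / 2"
    unfolding d_def[symmetric] R_def using pos by (simp add: field_simps)
  have "tail (card S) \<le> 2 * 1 / ((1 - 1 / A) * R)"
    by (rule sampling_lower_bound[OF alg zero_less_one R]) (simp add: S[OF R])
  then show False using eq tail_pos[of "card S"] by simp
qed

end

section \<open>Optimality of the adaptive algorithm on the cone\<close>

theorem theorem3:
  fixes \<tau> \<rho> \<rho>' :: ennreal
    and lam :: "'k \<Rightarrow> real"
    and k :: "nat \<Rightarrow> 'k"
    and n1 :: nat
    and A :: real
    and C :: "('k \<Rightarrow> 'a::{real_normed_field,banach}) set"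
    and ALG :: "('k, 'a) algorithm"
  assumes exponents: "1 \<le> \<tau>" "\<tau> \<le> \<rho>" "inverse \<rho> + inverse \<rho>' = inverse \<tau>"
    and enumeration: "bij_betw k {1..} (UNIV :: 'k set)"
    and weights_pos: "\<And>j. 0 < lam j"
    and weights_decreasing: "\<And>i. 1 \<le> i \<Longrightarrow> lam (k (i + 1)) \<le> lam (k i)"
    and weights_finite: "lp_finite \<rho>' UNIV lam"
    and n1: "1 \<le> n1"
    and A: "1 < A"
    and C: "C = data_cone \<rho> lam k n1 A"
    and ALG: "ALG = cone_alg \<rho> \<rho>' lam k n1 A"
  shows
    "((\<tau> < \<rho> \<or> (\<lambda>i. lam (k i)) \<longlonglongrightarrow> 0 \<longrightarrow> ALG \<in> algorithms \<tau> C) \<and>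
      (\<forall>\<epsilon>>0. \<forall>f\<in>C. \<forall>g. returns ALG \<epsilon> f g \<longrightarrow>
         g \<in> G_space \<tau> \<and> G_norm \<tau> (\<lambda>j. SOL f j - g j) \<le> \<epsilon>))
     \<and>
     (\<forall>\<epsilon>>0. \<forall>R>0. COST \<rho> lam ALG C \<epsilon> R =
        first_n (\<lambda>n. n1 \<le> n \<and> tail_norm \<rho>' lam k n \<le> \<epsilon> / (inflation \<rho> A * R)))
     \<and>
     (\<exists>\<epsilon>max>0. \<exists>Rmin>0. \<forall>\<epsilon> R. 0 < \<epsilon> \<longrightarrow> \<epsilon> \<le> \<epsilon>max \<longrightarrow> Rmin \<le> R \<longrightarrow>
        first_n (\<lambda>n. n1 \<le> n \<and> tail_norm \<rho>' lam k n \<le> 2 * \<epsilon> / ((1 - 1 / A) * R))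
          \<le> COMP \<tau> \<rho> lam C \<epsilon> R)
     \<and>
     essentially_optimal \<tau> \<rho> lam C ALG
     \<and>
     (\<forall>alg \<in> algorithms \<tau> C. \<not> non_adaptive C alg)"
proof -
  interpret cone_problem \<tau> \<rho> \<rho>' lam k n1 A
    by unfold_locales (use assms in auto)
  have finite_rho': "\<rho>' \<noteq> \<infinity>" if "\<tau> < \<rho>"
    using that rho'_infinite by blast
  show ?thesis
    unfolding C ALG
  proof (intro conjI impI allI ballI)
    show "cone_alg \<rho> \<rho>' lam k n1 A \<in> algorithms \<tau> (data_cone \<rho> lam k n1 A :: ('k \<Rightarrow> 'a) set)"
      if "\<tau> < \<rho> \<or> (\<lambda>i. lam (k i)) \<longlonglongrightarrow> 0"
      using that finite_rho' by (intro cone_alg_in_algorithms) blast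
  qed (rule cone_alg_correct COST_cone_alg COMP_lower_bound_eventually cone_alg_essentially_optimal
      algorithms_adaptive; assumption)+
qed

end
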